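(* Let $H$ be a time-independent, hermitian, number-parity-preserving Hamiltonian on $h$, and define the fermionic quantum action operator on $\mathcal H$ by $$e^{i\mathcal S}:=e^{i\epsilon\mathcal P}\prod_{t=0}^{N-1}e^{-i\epsilon H_t}.$$ Let $O^{(1)},\dots,O^{(k)}$ be arbitrary operators on $h$ and $t_1,\dots,t_k\in\{0,\dots,N-1\}$, where repetitions are allowed. Then $$\mathrm{Tr}\Big[P\,e^{i\mathcal S}\,O^{(1)}_{t_1}O^{(2)}_{t_2}\cdots O^{(k)}_{t_k}\Big]=\mathrm{tr}\Big[e^{-iTH}\,\hat T\big[O^{(1)}(\epsilon t_1)\cdots O^{(k)}(\epsilon t_k)\big]\Big],$$ where $O(s):=e^{isH}Oe^{-isH}$ denotes the Heisenberg-picture operator.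
   Context: Fix integers $L\ge1$, $N\ge1$, a real $\epsilon>0$, and set $T=\epsilon N$. The space $h$ and its trace. Let $h$ be the fermionic Fock space of $L$ modes, so $\dim h=2^L$. It is generated from a vacuum $|0\rangle$ by operators $a_i$, $i=1,\dots,L$, with $a_i|0\rangle=0$, $\{a_i,a_j^\dagger\}=\delta_{ij}$ and $\{a_i,a_j\}=\{a_i^\dagger,a_j^\dagger\}=0$. The symbol $\mathrm{tr}$ denotes the trace on $h$. The space $\mathcal H$ and its trace. Let $\mathcal H$ be the Fock space of $LN$ modes, so $\dim\mathcal H=2^{LN}$. It is generated from a vacuum $|\Omega\rangle$ by operators $a_{ti}$, $t=0,\dots,N-1$, $i=1,\dots,L$, with $a_{ti}|\Omega\rangle=0$, $\{a_{ti},a^\dagger_{t'j}\}=\delta_{tt'}\delta_{ij}$ and $\{a_{ti},a_{t'j}\}=\{a^\dagger_{ti},a^\dagger_{t'j}\}=0$. In particular, ladder operators with different time labels $t$ anticommute. The symbol $\mathrm{Tr}$ denotes the trace on $\mathcal H$. Time translations and parity. Set $\omega_n=(2n+1)\pi/T$ and $\hat a_{ni}:=N^{-1/2}\sum_{t=0}^{N-1}e^{i\omega_n\epsilon t}a_{ti}$ for $n=0,\dots,N-1$. Define $$\mathcal P:=\sum_{n=0}^{N-1}\sum_{j}\omega_n\hat a^\dagger_{nj}\hat a_{nj},\qquad P:=\exp\Big(i\pi\sum_{t,i}a^\dagger_{ti}a_{ti}\Big).$$ Placing operators on a slice. For an operator $O$ on $h$ and a slice $t$, $O_t$ denotes the image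 of $O$ under the unital $*$-homomorphism from operators on $h$ to operators on $\mathcal H$ determined by $a_i\mapsto a_{ti}$. Equivalently, one writes $O$ as a polynomial in $a_i,a_j^\dagger$ and substitutes $a_i\to a_{ti}$, $a_j^\dagger\to a_{tj}^\dagger$. Parity-preserving Hamiltonians. An operator on $h$ is even (resp. odd) if it commutes (resp. anticommutes) with $e^{i\pi\sum_i a_i^\dagger a_i}$. A Hamiltonian $H$ is parity preserving if it is even, i.e. a polynomial in the ladder operators each monomial of which has an even number of factors. We write $H_t$ for $H$ placed on slice $t$. Fermionic time ordering $\hat T$. Let $B_1,\dots,B_k$ be operators on $h$ of definite parity, with real time labels $s_1,\dots,s_k$. Let $\sigma$ be the unique permutation such that $s_{\sigma(1)}\ge s_{\sigma(2)}\ge\dots\ge s_{\sigma(k)}$ and such that entries with equal labels keep their original relative order. Define $$\hat T[B_1\cdots B_k]:=(-1)^\gamma B_{\sigma(1)}\cdots B_{\sigma(k)},$$ where $\gamma$ is the number of pairs of odd operators whose relative order is reversed by $\sigma$. Later times thus appear to the left. $\hat T$ is extended multilinearly to arbitrary operators by splitting each into its even and odd parts. In the present statement the label of $O^{(l)}(\epsilon t_l)$ is $\epsilon t_l$. *)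

theory Defs
  imports Complex_Main
begin

text \<open>
  Fermionic Fock space of M modes (modes numbered 0..M-1) in the occupation-number
  basis: basis vectors are indexed by the sets S of occupied modes, S in Pow {..<M}.
  An operator is represented by its matrix entries <S|A|U>. Only entries with
  S, U in Pow {..<M} are meaningful; all operations below only ever read those.
\<close>

type_synonym fop = "nat set \<Rightarrow> nat set \<Rightarrow> complex"

definition fmul :: "nat \<Rightarrow> fop \<Rightarrow> fop \<Rightarrow> fop" where
  "fmul M A B = (\<lambda>S U. \<Sum>T\<in>Pow {..<M}. A S T * B T U)"

definition fid :: fop where
  "fid = (\<lambda>S U. if S = U then 1 else 0)"

definition fadd :: "fop \<Rightarrow> fop \<Rightarrow> fop" where
  "fadd A B = (\<lambda>S U. A S U + B S U)"

definition fscale :: "complex \<Rightarrow> fop \<Rightarrow> fop" where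
  "fscale c A = (\<lambda>S U. c * A S U)"

definition fsum :: "'a set \<Rightarrow> ('a \<Rightarrow> fop) \<Rightarrow> fop" where
  "fsum I F = (\<lambda>S U. \<Sum>x\<in>I. F x S U)"

definition fadj :: "fop \<Rightarrow> fop" where
  "fadj A = (\<lambda>S U. cnj (A U S))"

text \<open>Annihilation operator of mode m (Jordan-Wigner sign convention).\<close>
definition fann :: "nat \<Rightarrow> fop" where
  "fann m = (\<lambda>S U. if m \<in> U \<and> S = U - {m} then (-1) ^ card {j\<in>U. j < m} else 0)"

definition fcre :: "nat \<Rightarrow> fop" where
  "fcre m = fadj (fann m)"

fun fpow :: "nat \<Rightarrow> fop \<Rightarrow> nat \<Rightarrow> fop" where
  "fpow M A 0 = fid"
| "fpow M A (Suc n) = fmul M A (fpow M A n)"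

definition fexp :: "nat \<Rightarrow> fop \<Rightarrow> fop" where
  "fexp M A = (\<lambda>S U. \<Sum>n. fpow M A n S U / of_nat (fact n))"

definition ftr :: "nat \<Rightarrow> fop \<Rightarrow> complex" where
  "ftr M A = (\<Sum>S\<in>Pow {..<M}. A S S)"

definition fprod :: "nat \<Rightarrow> fop list \<Rightarrow> fop" where
  "fprod M As = foldr (fmul M) As fid"

definition parity_h :: "nat \<Rightarrow> fop" where
  "parity_h L = fexp L (fscale (\<i> * pi) (fsum {..<L} (\<lambda>i. fmul L (fcre i) (fann i))))"

definition hermitian_op :: "nat \<Rightarrow> fop \<Rightarrow> bool" where
  "hermitian_op M A \<longleftrightarrow> (\<forall>S\<in>Pow {..<M}. \<forall>U\<in>Pow {..<M}. A S U = cnj (A U S))"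

definition even_op :: "nat \<Rightarrow> fop \<Rightarrow> bool" where
  "even_op L A \<longleftrightarrow> (\<forall>S\<in>Pow {..<L}. \<forall>U\<in>Pow {..<L}.
      fmul L A (parity_h L) S U = fmul L (parity_h L) A S U)"

text \<open>The big space \<H>: LN modes; mode (t,i) is numbered t*L+i.\<close>
definition slot :: "nat \<Rightarrow> nat \<Rightarrow> nat \<Rightarrow> nat" where
  "slot L t i = t * L + i"

text \<open>
  O_t: image of O under the unital *-homomorphism a_i \<mapsto> a_{ti}. We expand
  O = sum_{S,U} <S|O|U> |S><U| with the polynomial
  |S><U| = a^dag_{s1}...a^dag_{sk} (prod_i a_i a_i^dag) a_{um}...a_{u1}
  (s1<...<sk, u1<...<um) and substitute a_i \<mapsto> a_{ti}.
\<close>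
definition emb :: "nat \<Rightarrow> nat \<Rightarrow> nat \<Rightarrow> fop \<Rightarrow> fop" where
  "emb L N t A = fsum (Pow {..<L} \<times> Pow {..<L}) (\<lambda>(S, U).
     fscale (A S U) (fprod (L * N)
       (map (\<lambda>i. fcre (slot L t i)) (sorted_list_of_set S)
        @ map (\<lambda>i. fmul (L * N) (fann (slot L t i)) (fcre (slot L t i))) [0..<L]
        @ map (\<lambda>i. fann (slot L t i)) (rev (sorted_list_of_set U)))))"

definition parity_big :: "nat \<Rightarrow> nat \<Rightarrow> fop" where
  "parity_big L N = fexp (L * N) (fscale (\<i> * pi)
     (fsum ({..<N} \<times> {..<L}) (\<lambda>(t, i). fmul (L * N) (fcre (slot L t i)) (fann (slot L t i)))))"

definition omega :: "real \<Rightarrow> nat \<Rightarrow> nat \<Rightarrow> real" where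
  "omega \<epsilon> N n = (2 * real n + 1) * pi / (\<epsilon> * real N)"

definition ahat :: "nat \<Rightarrow> nat \<Rightarrow> real \<Rightarrow> nat \<Rightarrow> nat \<Rightarrow> fop" where
  "ahat L N \<epsilon> n i = fscale (1 / complex_of_real (sqrt (real N)))
     (fsum {..<N} (\<lambda>t. fscale (exp (\<i> * complex_of_real (omega \<epsilon> N n * \<epsilon> * real t)))
        (fann (slot L t i))))"

definition momentum :: "nat \<Rightarrow> nat \<Rightarrow> real \<Rightarrow> fop" where
  "momentum L N \<epsilon> = fsum ({..<N} \<times> {..<L}) (\<lambda>(n, j).
     fscale (complex_of_real (omega \<epsilon> N n)) (fmul (L * N) (fadj (ahat L N \<epsilon> n j)) (ahat L N \<epsilon> n j)))"

definition action_op :: "nat \<Rightarrow> nat \<Rightarrow> real \<Rightarrow> fop \<Rightarrow> fop" where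
  "action_op L N \<epsilon> H = fmul (L * N) (fexp (L * N) (fscale (\<i> * \<epsilon>) (momentum L N \<epsilon>)))
     (fprod (L * N) (map (\<lambda>t. fexp (L * N) (fscale (- \<i> * \<epsilon>) (emb L N t H))) [0..<N]))"

definition heis :: "nat \<Rightarrow> fop \<Rightarrow> real \<Rightarrow> fop \<Rightarrow> fop" where
  "heis L H s A = fmul L (fexp L (fscale (\<i> * s) H)) (fmul L A (fexp L (fscale (- \<i> * s) H)))"

definition even_part :: "nat \<Rightarrow> fop \<Rightarrow> fop" where
  "even_part L A = fscale (1/2) (fadd A (fmul L (parity_h L) (fmul L A (parity_h L))))"

definition odd_part :: "nat \<Rightarrow> fop \<Rightarrow> fop" where
  "odd_part L A = fscale (1/2) (fadd A (fscale (-1) (fmul L (parity_h L) (fmul L A (parity_h L)))))"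

text \<open>
  The permutation sigma as a list [sigma(1),...,sigma(k)] (0-indexed): indices sorted by
  decreasing label, stable (sort_key is stable).
\<close>
definition tord_perm :: "(nat \<Rightarrow> real) \<Rightarrow> nat \<Rightarrow> nat list" where
  "tord_perm lab k = sort_key (\<lambda>l. - lab l) [0..<k]"

text \<open>gamma: number of pairs of odd operators (odd flagged by cs) whose order sigma reverses.\<close>
definition tord_gamma :: "(nat \<Rightarrow> real) \<Rightarrow> nat \<Rightarrow> bool list \<Rightarrow> nat" where
  "tord_gamma lab k cs = card {(p, q). p < q \<and> q < k \<and>
      tord_perm lab k ! q < tord_perm lab k ! p \<and>
      cs ! (tord_perm lab k ! p) \<and> cs ! (tord_perm lab k ! q)}"

text \<open>
  Fermionic time ordering of B_0 ... B_{k-1} with labels lab, extended multilinearly: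
  each B_l is split into even and odd parts (cs ! l = True selects the odd part).
\<close>
definition tord :: "nat \<Rightarrow> (nat \<Rightarrow> real) \<Rightarrow> (nat \<Rightarrow> fop) \<Rightarrow> nat \<Rightarrow> fop" where
  "tord L lab B k = fsum {cs :: bool list. length cs = k} (\<lambda>cs.
     fscale ((-1) ^ tord_gamma lab k cs)
       (fprod L (map (\<lambda>l. if cs ! l then odd_part L (B l) else even_part L (B l))
                     (tord_perm lab k))))"

end

theory Submission
  imports Defs
begin

text \<open>
  Conjugation by \<open>exp (i \<epsilon> \<P>)\<close> multiplies the creation operator of frequency \<open>\<omega>\<^sub>n\<close> by
  \<open>exp (i \<epsilon> \<omega>\<^sub>n)\<close>, hence it moves slice \<open>t\<close> to slice \<open>t + 1\<close>, with a sign when the last slice wraps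
  around. Together with the vacuum being fixed this gives all matrix entries of the translation.
  An operator placed on slice \<open>t\<close> acts on the occupation of that slice, up to a Jordan-Wigner sign
  counting the particles on earlier slices. So for operators \<open>Y\<^sub>t\<close> placed on the slices in
  decreasing order, the trace against parity and translation is the sum over occupations \<open>S\<^sub>t\<close> of
  \<open>\<Prod>\<^sub>t \<langle>S\<^sub>t| Y\<^sub>t |S\<^sub>t\<^sub>-\<^sub>1\<rangle>\<close> with cyclic index, all signs cancelling; this is the trace of
  \<open>Y\<^sub>N\<^sub>-\<^sub>1 \<dots> Y\<^sub>0\<close>. Insertions of definite parity on distinct slices commute up to the sign that
  defines the time ordering, and the Heisenberg factors telescope to one \<open>exp (- i \<epsilon> H)\<close> per slice.
\<close>

section \<open>Operators as matrices\<close>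

text \<open>No eigenbasis of the translation is built: the commutator of \<open>momentum\<close>
  with a frequency creator is exponentiated directly, and the translation is then known from its
  value on the vacuum. The wrap sign is \<open>e^{i \<omega>_n T} = -1\<close>, a consequence of the
  half-integer frequencies. In the trace this sign, the parity operator and the reordering signs of
  the wrapped modes only cancel together; \<open>cyclic_sign_even\<close> is the counting identity
  behind this, and it holds for arbitrary slice operators, whatever their parity. The evolution
  factors of the action stand in ascending slice order, whereas the path sum wants descending order.
  Evenness of \<open>H\<close> bridges this gap, because an even operator commutes with everything
  on another slice. Insertions of mixed parity have no exchange sign, so both sides are expanded
  over the same choices of even and odd parts and compared term by term. Insertions on one slice
  need not commute at all; hence the sorting is stable and exchanges only distinct labels, which for
  \<open>\<epsilon> > 0\<close> are the same as distinct slices.\<close>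

lemma fmul_assoc: "fmul M (fmul M A B) C = fmul M A (fmul M B C)"
proof (intro ext)
  fix S U
  have "fmul M (fmul M A B) C S U =
      (\<Sum>T\<in>Pow {..<M}. \<Sum>R\<in>Pow {..<M}. A S R * B R T * C T U)"
    by (simp add: fmul_def sum_distrib_right)
  also have "\<dots> = (\<Sum>R\<in>Pow {..<M}. \<Sum>T\<in>Pow {..<M}. A S R * B R T * C T U)"
    by (rule sum.swap)
  also have "\<dots> = fmul M A (fmul M B C) S U"
    by (simp add: fmul_def sum_distrib_left mult.assoc)
  finally show "fmul M (fmul M A B) C S U = fmul M A (fmul M B C) S U" .
qed

lemma fmul_cong:
  assumes "\<And>T. T \<subseteq> {..<M} \<Longrightarrow> A S T = A' S' T" "\<And>T. T \<subseteq> {..<M} \<Longrightarrow> B T U = B' T U'"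
  shows "fmul M A B S U = fmul M A' B' S' U'"
  unfolding fmul_def using assms by (intro sum.cong) auto

lemma fmul_fscale_left: "fmul M (fscale c A) B = fscale c (fmul M A B)"
  by (intro ext) (simp add: fmul_def fscale_def sum_distrib_left mult.assoc)

lemma fmul_fscale_right: "fmul M A (fscale c B) = fscale c (fmul M A B)"
  by (intro ext) (simp add: fmul_def fscale_def sum_distrib_left mult.left_commute)

lemma fmul_fadd_right: "fmul M A (fadd B C) = fadd (fmul M A B) (fmul M A C)"
  by (intro ext) (simp add: fmul_def fadd_def distrib_left sum.distrib)

lemma fmul_fsum_left: "fmul M (fsum I F) B = fsum I (\<lambda>x. fmul M (F x) B)"
  by (intro ext) (simp add: fmul_def fsum_def sum_distrib_right, rule sum.swap)

lemma fmul_fsum_right: "fmul M A (fsum I F) = fsum I (\<lambda>x. fmul M A (F x))"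
  by (intro ext) (simp add: fmul_def fsum_def sum_distrib_left, rule sum.swap)

lemma fmul_fid_left: "S \<subseteq> {..<M} \<Longrightarrow> fmul M fid A S U = A S U"
proof -
  assume S: "S \<subseteq> {..<M}"
  have "fmul M fid A S U = (\<Sum>T\<in>Pow {..<M}. if S = T then A T U else 0)"
    unfolding fmul_def fid_def by (intro sum.cong) auto
  with S show ?thesis by simp
qed

lemma fmul_fid_right: "U \<subseteq> {..<M} \<Longrightarrow> fmul M A fid S U = A S U"
proof -
  assume U: "U \<subseteq> {..<M}"
  have "fmul M A fid S U = (\<Sum>T\<in>Pow {..<M}. if T = U then A S T else 0)"
    unfolding fmul_def fid_def by (intro sum.cong) auto
  with U show ?thesis by simp
qed

text \<open>Entries outside the Fock space are junk. The operators vanishing there are the fixed points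
  of \<open>fres\<close>; on them \<open>fone\<close> is a genuine two-sided unit, which \<open>fid\<close> is not.\<close>

definition fres :: "nat \<Rightarrow> fop \<Rightarrow> fop" where
  "fres M A = (\<lambda>S U. if S \<subseteq> {..<M} \<and> U \<subseteq> {..<M} then A S U else 0)"

definition fone :: "nat \<Rightarrow> fop" where
  "fone M = fres M fid"

text \<open>This is \<open>fprod\<close> ending in \<open>fone\<close> instead of
  \<open>fid\<close>, so that a product of fixed points of \<open>fres\<close> is again a fixed
  point, also when the list is empty.\<close>

definition mprod :: "nat \<Rightarrow> fop list \<Rightarrow> fop" where
  "mprod M As = foldr (fmul M) As (fone M)"

lemma fres_eqI:
  assumes "\<And>S U. S \<subseteq> {..<M} \<Longrightarrow> U \<subseteq> {..<M} \<Longrightarrow> A S U = B S U"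
  shows "fres M A = fres M B"
  using assms by (auto simp: fres_def fun_eq_iff)

lemma fres_eqD: "fres M A = fres M B \<Longrightarrow> S \<subseteq> {..<M} \<Longrightarrow> U \<subseteq> {..<M} \<Longrightarrow> A S U = B S U"
  by (metis fres_def)

lemma fres_apply [simp]: "S \<subseteq> {..<M} \<Longrightarrow> U \<subseteq> {..<M} \<Longrightarrow> fres M A S U = A S U"
  by (simp add: fres_def)

lemma fres_fres [simp]: "fres M (fres M A) = fres M A"
  by (auto simp: fres_def fun_eq_iff)

text \<open>The intermediate states of \<open>fmul\<close> never leave the Fock space, so truncation
  only touches the outer indices. This lets whole products inside a trace be replaced by products of
  truncated factors, for which equalities of functions are available.\<close>

lemma fres_fmul: "fres M (fmul M A B) = fmul M (fres M A) (fres M B)"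
proof (intro ext)
  fix S U
  show "fres M (fmul M A B) S U = fmul M (fres M A) (fres M B) S U"
  proof (cases "S \<subseteq> {..<M} \<and> U \<subseteq> {..<M}")
    case True
    then show ?thesis by (auto simp: fmul_def)
  next
    case False
    then have "fres M A S T * fres M B T U = 0" for T
      by (auto simp: fres_def)
    then have "fmul M (fres M A) (fres M B) S U = 0"
      unfolding fmul_def by (intro sum.neutral) blast
    with False show ?thesis
      by (auto simp: fres_def)
  qed
qed

lemma fres_fscale: "fres M (fscale c A) = fscale c (fres M A)"
  by (intro ext) (auto simp: fres_def fscale_def)

lemma fres_fsum: "fres M (fsum I F) = fsum I (\<lambda>x. fres M (F x))"
proof (intro ext)
  fix S U
  show "fres M (fsum I F) S U = fsum I (\<lambda>x. fres M (F x)) S U"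
    by (cases "S \<subseteq> {..<M} \<and> U \<subseteq> {..<M}")
      (simp_all only: fres_def fsum_def if_True if_False simp_thms sum.neutral_const)
qed

lemma fone_left [simp]: "fmul M (fone M) (fres M A) = fres M A"
  unfolding fone_def fres_fmul[symmetric] by (intro fres_eqI) (simp add: fmul_fid_left)

lemma fone_right [simp]: "fmul M (fres M A) (fone M) = fres M A"
  unfolding fone_def fres_fmul[symmetric] by (intro fres_eqI) (simp add: fmul_fid_right)

lemma fres_fone [simp]: "fres M (fone M) = fone M"
  by (simp add: fone_def)

lemma fone_fone [simp]: "fmul M (fone M) (fone M) = fone M"
  using fone_left[of M "fone M"] by simp

lemma ftr_fres: "ftr M (fres M A) = ftr M A"
  by (simp add: ftr_def)

lemma ftr_fscale: "ftr M (fscale c A) = c * ftr M A"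
  by (simp add: ftr_def fscale_def sum_distrib_left)

lemma ftr_fsum: "ftr M (fsum I F) = (\<Sum>x\<in>I. ftr M (F x))"
  unfolding ftr_def fsum_def by (rule sum.swap)

lemma mprod_Nil [simp]: "mprod M [] = fone M"
  by (simp add: mprod_def)

lemma mprod_Cons [simp]: "mprod M (A # As) = fmul M A (mprod M As)"
  by (simp add: mprod_def)

lemma fres_fprod: "fres M (fprod M As) = mprod M (map (fres M) As)"
  by (induction As) (simp_all add: fprod_def fone_def fres_fmul)

lemma fres_fmul_closed:
  "fres M A = A \<Longrightarrow> fres M B = B \<Longrightarrow> fres M (fmul M A B) = fmul M A B"
  by (simp add: fres_fmul)

lemma fres_mprod:
  "(\<And>A. A \<in> set As \<Longrightarrow> fres M A = A) \<Longrightarrow> fres M (mprod M As) = mprod M As"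
  by (induction As) (simp_all add: fres_fmul)

lemma mprod_append:
  assumes "\<And>A. A \<in> set Bs \<Longrightarrow> fres M A = A"
  shows "mprod M (As @ Bs) = fmul M (mprod M As) (mprod M Bs)"
proof (induction As)
  case Nil
  have "fres M (mprod M Bs) = mprod M Bs"
    using assms by (rule fres_mprod)
  then show ?case
    by (metis append_Nil fone_left mprod_Nil)
qed (simp add: fmul_assoc)

lemma mprod_snoc:
  assumes "fres M A = A"
  shows "mprod M (As @ [A]) = fmul M (mprod M As) A"
  using mprod_append[of "[A]" M As] fone_right[of M A] by (simp add: assms)

section \<open>Exponentials\<close>

text \<open>The constant is the sum of the norms of all entries of \<open>A\<close>; it dominates
  every row sum, so each further factor \<open>A\<close> costs at most one factor \<open>?K\<close>.
  This yields the summable majorant \<open>?K ^ n / fact n\<close> for the exponential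
  series.\<close>

lemma norm_fpow_le:
  assumes "S \<subseteq> {..<M}"
  shows "norm (fpow M A n S U) \<le> (\<Sum>(S, T)\<in>Pow {..<M} \<times> Pow {..<M}. norm (A S T)) ^ n"
    (is "_ \<le> ?K ^ n")
  using assms
proof (induction n arbitrary: S)
  case 0
  then show ?case by (simp add: fid_def)
next
  case (Suc n)
  have "norm (fpow M A (Suc n) S U) \<le> (\<Sum>T\<in>Pow {..<M}. norm (A S T * fpow M A n T U))"
    by (simp add: fmul_def norm_sum)
  also have "\<dots> \<le> (\<Sum>T\<in>Pow {..<M}. norm (A S T) * ?K ^ n)"
    using Suc.IH by (intro sum_mono) (simp add: norm_mult mult_left_mono)
  also have "\<dots> = (\<Sum>T\<in>Pow {..<M}. norm (A S T)) * ?K ^ n"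
    by (simp add: sum_distrib_right)
  also have "\<dots> \<le> ?K * ?K ^ n"
  proof (rule mult_right_mono)
    have "(\<Sum>T\<in>Pow {..<M}. norm (A S T)) = (\<Sum>x\<in>{S} \<times> Pow {..<M}. norm (case x of (S, T) \<Rightarrow> A S T))"
      by (rule sum.reindex_bij_witness[of _ snd "Pair S"]) auto
    also have "\<dots> \<le> (\<Sum>x\<in>Pow {..<M} \<times> Pow {..<M}. norm (case x of (S, T) \<Rightarrow> A S T))"
      using Suc.prems by (intro sum_mono2) auto
    finally show "(\<Sum>T\<in>Pow {..<M}. norm (A S T)) \<le> ?K"
      by (simp add: case_prod_unfold)
  qed (auto intro!: zero_le_power sum_nonneg)
  finally show ?case by simp
qed

lemma summable_norm_fexp:
  assumes "S \<subseteq> {..<M}"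
  shows "summable (\<lambda>n. norm (fpow M A n S U / of_nat (fact n)))"
proof (rule summable_comparison_test')
  let ?K = "\<Sum>(S, T)\<in>Pow {..<M} \<times> Pow {..<M}. norm (A S T)"
  show "summable (\<lambda>n. ?K ^ n / fact n)"
    using summable_exp[of ?K] by (simp add: field_simps)
  show "norm (norm (fpow M A n S U / of_nat (fact n))) \<le> ?K ^ n / fact n" if "0 \<le> n" for n
    using norm_fpow_le[OF assms, of A n U] by (simp add: norm_divide divide_right_mono)
qed

lemma fexp_sums:
  assumes "S \<subseteq> {..<M}"
  shows "(\<lambda>n. fpow M A n S U / of_nat (fact n)) sums fexp M A S U"
  unfolding fexp_def using summable_norm_cancel[OF summable_norm_fexp[OF assms]]
  by (rule summable_sums)

lemma fpow_fscale: "fpow M (fscale c A) n = fscale (c ^ n) (fpow M A n)"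
  by (induction n) (auto simp: fmul_fscale_left fmul_fscale_right, auto simp: fscale_def mult_ac)

lemma fpow_add: "S \<subseteq> {..<M} \<Longrightarrow> fmul M (fpow M A i) (fpow M A j) S U = fpow M A (i + j) S U"
  by (induction i arbitrary: S) (auto simp: fmul_fid_left fmul_assoc intro: fmul_cong)

lemma fexp_zero: "fexp M (fscale 0 A) S U = fid S U"
proof -
  have "fpow M (fscale 0 A) n S U / of_nat (fact n) = (if n = 0 then fid S U else 0)" for n
    by (simp only: fpow_fscale) (simp add: fscale_def power_0_left)
  then show ?thesis
    using sums_unique[OF sums_single[of 0 "\<lambda>_. fid S U"]] by (simp add: fexp_def)
qed

lemma binomial_exp_coeff:
  fixes a b :: complex
  shows "(\<Sum>i\<le>n. a ^ i / of_nat (fact i) * (b ^ (n - i) / of_nat (fact (n - i)))) =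
    (a + b) ^ n / of_nat (fact n)"
proof -
  have "(a + b) ^ n / fact n = (\<Sum>i\<le>n. of_nat (n choose i) * a ^ i * b ^ (n - i) / fact n)"
    by (simp add: binomial_ring sum_divide_distrib)
  also have "\<dots> = (\<Sum>i\<le>n. a ^ i / fact i * (b ^ (n - i) / fact (n - i)))"
    by (intro sum.cong) (simp_all add: binomial_fact field_simps)
  finally show ?thesis by simp
qed

text \<open>For each intermediate state the two series are multiplied as a Cauchy product of
  absolutely convergent series of numbers; the finite sum over intermediate states then joins the
  powers of \<open>A\<close>, and the coefficients combine by the binomial theorem.\<close>

lemma fexp_add:
  assumes S: "S \<subseteq> {..<M}"
  shows "fmul M (fexp M (fscale a A)) (fexp M (fscale b A)) S U = fexp M (fscale (a + b) A) S U"
proof -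
  define x where "x = (\<lambda>T n. a ^ n * fpow M A n S T / of_nat (fact n))"
  define y where "y = (\<lambda>T n. b ^ n * fpow M A n T U / of_nat (fact n))"
  have x: "summable (\<lambda>n. norm (x T n))" "suminf (x T) = fexp M (fscale a A) S T" for T
    using summable_norm_fexp[OF S, of "fscale a A" T]
    by (simp_all add: x_def fexp_def fpow_fscale, simp_all add: fscale_def)
  have y: "summable (\<lambda>n. norm (y T n))" "suminf (y T) = fexp M (fscale b A) T U"
    if "T \<subseteq> {..<M}" for T
    using summable_norm_fexp[OF that, of "fscale b A" U]
    by (simp_all add: y_def fexp_def fpow_fscale, simp_all add: fscale_def)
  have "(\<lambda>n. \<Sum>T\<in>Pow {..<M}. \<Sum>i\<le>n. x T i * y T (n - i)) sums
      (\<Sum>T\<in>Pow {..<M}. fexp M (fscale a A) S T * fexp M (fscale b A) T U)"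
  proof (rule sums_sum)
    fix T assume "T \<in> Pow {..<M}"
    then show "(\<lambda>n. \<Sum>i\<le>n. x T i * y T (n - i)) sums
        (fexp M (fscale a A) S T * fexp M (fscale b A) T U)"
      using Cauchy_product_sums[of "x T" "y T"] x y by simp
  qed
  moreover have "(\<Sum>T\<in>Pow {..<M}. \<Sum>i\<le>n. x T i * y T (n - i)) =
      fpow M (fscale (a + b) A) n S U / of_nat (fact n)" for n
  proof -
    have "(\<Sum>T\<in>Pow {..<M}. \<Sum>i\<le>n. x T i * y T (n - i)) =
        (\<Sum>i\<le>n. \<Sum>T\<in>Pow {..<M}. x T i * y T (n - i))"
      by (rule sum.swap)
    also have "\<dots> = (\<Sum>i\<le>n. a ^ i / of_nat (fact i) * (b ^ (n - i) / of_nat (fact (n - i)))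
        * fmul M (fpow M A i) (fpow M A (n - i)) S U)"
      unfolding x_def y_def fmul_def sum_distrib_left by (intro sum.cong) auto
    also have "\<dots> = (\<Sum>i\<le>n. a ^ i / of_nat (fact i) * (b ^ (n - i) / of_nat (fact (n - i)))
        * fpow M A n S U)"
      using S by (intro sum.cong) (simp_all add: fpow_add)
    also have "\<dots> = (a + b) ^ n / of_nat (fact n) * fpow M A n S U"
      by (simp only: binomial_exp_coeff sum_distrib_right[symmetric])
    finally show ?thesis
      by (simp add: fpow_fscale) (simp add: fscale_def)
  qed
  ultimately have "(\<lambda>n. fpow M (fscale (a + b) A) n S U / of_nat (fact n)) sums
      fmul M (fexp M (fscale a A)) (fexp M (fscale b A)) S U"
    by (simp add: fmul_def)
  then show ?thesis
    by (simp add: fexp_def sums_iff)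
qed

text \<open>The two-index array \<open>u i j = A\<^sup>i Y A\<^sup>j\<close> reduces the operator binomial theorem to
  a recursion between numbers.\<close>

lemma binomial_recursion:
  fixes u :: "nat \<Rightarrow> nat \<Rightarrow> complex"
  assumes "\<And>i j. u (Suc i) j = u i (Suc j) + z * u i j"
  shows "u n j / of_nat (fact n) =
    (\<Sum>i\<le>n. z ^ i / of_nat (fact i) * (u 0 (j + (n - i)) / of_nat (fact (n - i))))"
proof -
  have *: "u n j = (\<Sum>i\<le>n. of_nat (n choose i) * z ^ i * u 0 (j + (n - i)))" for n j
  proof (induction n arbitrary: j)
    case (Suc n)
    have "(\<Sum>i\<le>Suc n. of_nat (Suc n choose i) * z ^ i * u 0 (j + (Suc n - i))) =
        u 0 (j + Suc n) + (\<Sum>i\<le>n. of_nat (n choose Suc i) * z ^ Suc i * u 0 (j + (n - i)))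
        + z * (\<Sum>i\<le>n. of_nat (n choose i) * z ^ i * u 0 (j + (n - i)))"
      by (subst sum.atMost_Suc_shift)
        (simp add: algebra_simps sum.distrib sum_distrib_left)
    \<comment> \<open>Pascal's rule has split the sum in two. In this half the term
      \<open>i = Suc n\<close> vanishes because \<open>n choose Suc n = 0\<close>, and what remains
      is the expansion of \<open>u n (Suc j)\<close>.\<close>
    also have "u 0 (j + Suc n) + (\<Sum>i\<le>n. of_nat (n choose Suc i) * z ^ Suc i * u 0 (j + (n - i)))
        = (\<Sum>i\<le>Suc n. of_nat (n choose i) * z ^ i * u 0 (j + (Suc n - i)))"
      by (simp only: sum.atMost_Suc_shift) simp
    also have "\<dots> = (\<Sum>i\<le>n. of_nat (n choose i) * z ^ i * u 0 (Suc j + (n - i)))"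
      by (simp add: Suc_diff_le)
    finally show ?case
      by (simp only: assms Suc.IH)
  qed simp
  have "u n j / fact n = (\<Sum>i\<le>n. of_nat (n choose i) * z ^ i * u 0 (j + (n - i)) / fact n)"
    by (subst *) (simp add: sum_divide_distrib)
  also have "\<dots> = (\<Sum>i\<le>n. z ^ i / fact i * (u 0 (j + (n - i)) / fact (n - i)))"
    by (intro sum.cong) (simp_all add: binomial_fact field_simps)
  finally show ?thesis by simp
qed

text \<open>The hypothesis says \<open>A Y = Y (A + z)\<close>, so formally
  \<open>e^A Y = Y e^(A + z)\<close>. Entrywise, \<open>A^n Y / n!\<close> is the n-th term of the
  Cauchy product of the series of \<open>exp z\<close> and of \<open>Y e^A\<close>. Used with
  \<open>z\<close> a frequency for the translation, and with \<open>z = 0\<close> to pass a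
  commutation relation on to the exponential.\<close>

lemma fexp_shift_unscaled:
  assumes "\<And>S U. S \<subseteq> {..<M} \<Longrightarrow> U \<subseteq> {..<M} \<Longrightarrow> fmul M A Y S U = fmul M Y A S U + z * Y S U"
    and S: "S \<subseteq> {..<M}" and U: "U \<subseteq> {..<M}"
  shows "fmul M (fexp M A) Y S U = exp z * fmul M Y (fexp M A) S U"
proof -
  define u where "u i j = fmul M (fpow M A i) (fmul M Y (fpow M A j)) S U" for i j
  have rec: "u (Suc i) j = u i (Suc j) + z * u i j" for i j
  proof -
    have "u (Suc i) j = fmul M (fmul M (fpow M A i) A) (fmul M Y (fpow M A j)) S U"
      unfolding u_def
    proof (rule fmul_cong)
      fix T assume "T \<subseteq> {..<M}"
      \<comment> \<open>\<open>fpow\<close> adds new factors on the left, but the commutation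
        relation needs an \<open>A\<close> standing next to \<open>Y\<close>; additivity of powers
        moves it there.\<close>
      then have "fmul M (fpow M A i) (fpow M A 1) S T = fmul M (fpow M A i) A S T"
        by (intro fmul_cong) (auto simp: fmul_fid_right)
      then show "fpow M A (Suc i) S T = fmul M (fpow M A i) A S T"
        using fpow_add[OF S, of A i 1 T] by simp
    qed simp
    also have "\<dots> = fmul M (fpow M A i) (fmul M (fmul M A Y) (fpow M A j)) S U"
      by (simp add: fmul_assoc)
    also have "\<dots> = fmul M (fpow M A i)
        (fmul M (fadd (fmul M Y A) (fscale z Y)) (fpow M A j)) S U"
      using assms(1) by (intro fmul_cong) (auto simp: fadd_def fscale_def)
    also have "\<dots> = fmul M (fpow M A i) (fmul M (fmul M Y A) (fpow M A j)) S U + z * u i j"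
      unfolding u_def
      by (simp add: fmul_def fadd_def fscale_def ring_distribs sum.distrib sum_distrib_left mult_ac)
    also have "fmul M (fpow M A i) (fmul M (fmul M Y A) (fpow M A j)) S U = u i (Suc j)"
      by (simp add: u_def fmul_assoc)
    finally show ?thesis .
  qed
  have u0: "u 0 j = fmul M Y (fpow M A j) S U" for j
    using S by (simp add: u_def fmul_fid_left)
  have un: "u n 0 = fmul M (fpow M A n) Y S U" for n
    unfolding u_def using U by (intro fmul_cong) (auto simp: fmul_fid_right)
  have lhs: "(\<lambda>n. u n 0 / of_nat (fact n)) sums fmul M (fexp M A) Y S U"
  proof -
    have "(\<lambda>n. \<Sum>T\<in>Pow {..<M}. fpow M A n S T / of_nat (fact n) * Y T U) sums
        (\<Sum>T\<in>Pow {..<M}. fexp M A S T * Y T U)"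
      using S by (intro sums_sum sums_mult2 fexp_sums)
    then show ?thesis
      by (simp add: un fmul_def sum_divide_distrib)
  qed
  have summ: "summable (\<lambda>n. norm (u 0 n / of_nat (fact n)))"
  proof (rule summable_comparison_test')
    show "summable (\<lambda>n. \<Sum>T\<in>Pow {..<M}. norm (Y S T) * norm (fpow M A n T U / of_nat (fact n)))"
      by (intro summable_sum summable_mult summable_norm_fexp) auto
    show "norm (norm (u 0 n / of_nat (fact n))) \<le>
        (\<Sum>T\<in>Pow {..<M}. norm (Y S T) * norm (fpow M A n T U / of_nat (fact n)))" for n
      unfolding u0 fmul_def sum_divide_distrib real_norm_def abs_norm_cancel
      by (rule order_trans[OF norm_sum]) (simp add: norm_mult norm_divide)
  qed
  have rhs: "(\<lambda>n. u 0 n / of_nat (fact n)) sums fmul M Y (fexp M A) S U"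
  proof -
    have "(\<lambda>n. \<Sum>T\<in>Pow {..<M}. Y S T * (fpow M A n T U / of_nat (fact n))) sums
        (\<Sum>T\<in>Pow {..<M}. Y S T * fexp M A T U)"
      by (intro sums_sum sums_mult fexp_sums) auto
    then show ?thesis
      by (simp add: u0 fmul_def sum_divide_distrib)
  qed
  have "summable (\<lambda>n. norm (z ^ n / of_nat (fact n)))"
    using summable_norm_exp[of z] by (simp add: norm_divide norm_mult field_simps)
  from Cauchy_product_sums[OF this summ]
  have "(\<lambda>n. u n 0 / of_nat (fact n)) sums
      ((\<Sum>n. z ^ n / of_nat (fact n)) * (\<Sum>n. u 0 n / of_nat (fact n)))"
    by (subst binomial_recursion[of u z, OF rec]) simp
  moreover have "(\<Sum>n. z ^ n / of_nat (fact n)) = exp z"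
    by (simp add: exp_def scaleR_conv_of_real field_simps)
  ultimately show ?thesis
    using lhs rhs sums_unique2 by (metis sums_unique)
qed

lemma fexp_shift:
  assumes "\<And>S U. S \<subseteq> {..<M} \<Longrightarrow> U \<subseteq> {..<M} \<Longrightarrow> fmul M A Y S U = fmul M Y A S U + z * Y S U"
    and "S \<subseteq> {..<M}" and "U \<subseteq> {..<M}"
  shows "fmul M (fexp M (fscale c A)) Y S U = exp (c * z) * fmul M Y (fexp M (fscale c A)) S U"
proof (rule fexp_shift_unscaled)
  show "fmul M (fscale c A) Y S U = fmul M Y (fscale c A) S U + c * z * Y S U"
    if "S \<subseteq> {..<M}" "U \<subseteq> {..<M}" for S U
    using assms(1)[OF that] unfolding fmul_fscale_left fmul_fscale_right
    by (simp add: fscale_def algebra_simps)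
qed fact+

lemma fexp_diag:
  assumes "\<And>S U. S \<subseteq> {..<M} \<Longrightarrow> U \<subseteq> {..<M} \<Longrightarrow> A S U = (if S = U then d S else 0)"
    and S: "S \<subseteq> {..<M}" and U: "U \<subseteq> {..<M}"
  shows "fexp M A S U = (if S = U then exp (d S) else 0)"
proof -
  have "fpow M A n S U = (if S = U then d S ^ n else 0)" for n
    using S U
  proof (induction n arbitrary: S)
    case (Suc n)
    have "fpow M A (Suc n) S U = (\<Sum>T\<in>Pow {..<M}. if T = S then d S * fpow M A n T U else 0)"
      unfolding fpow.simps fmul_def using Suc.prems by (intro sum.cong) (auto simp: assms(1))
    also have "\<dots> = d S * fpow M A n S U"
      using Suc.prems by simp
    finally show ?case
      using Suc by simp
  qed (simp add: fid_def)
  moreover have "(\<Sum>n. d S ^ n / of_nat (fact n)) = exp (d S)"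
    by (simp add: exp_def scaleR_conv_of_real field_simps)
  ultimately show ?thesis
    by (cases "S = U") (simp_all add: fexp_def)
qed

section \<open>Ladder operators\<close>

lemma fann_apply:
  "fann m S U = (if m \<notin> S \<and> U = insert m S then (-1) ^ card {j\<in>S. j < m} else 0)"
proof -
  have "{j \<in> insert m S. j < m} = {j \<in> S. j < m}" by auto
  moreover have "m \<in> U \<and> S = U - {m} \<longleftrightarrow> m \<notin> S \<and> U = insert m S" by blast
  ultimately show ?thesis by (auto simp: fann_def)
qed

text \<open>A ladder operator has at most one nonzero entry per row, so multiplying by it from the
  left just selects a row of \<open>B\<close>. The bound on \<open>m\<close> keeps the selected row
  \<open>insert m S\<close> inside the Fock space.\<close>

lemma fmul_fann:
  assumes "S \<subseteq> {..<M}" "m < M"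
  shows "fmul M (fann m) B S U =
    (if m \<in> S then 0 else (-1) ^ card {j\<in>S. j < m} * B (insert m S) U)"
proof -
  have "fmul M (fann m) B S U = (\<Sum>T\<in>Pow {..<M}.
      if T = insert m S then (if m \<in> S then 0 else (-1) ^ card {j\<in>S. j < m} * B T U) else 0)"
    unfolding fmul_def by (intro sum.cong) (auto simp: fann_apply)
  then show ?thesis
    using assms by simp
qed

lemma fcre_apply:
  "fcre m S T = (if m \<in> S \<and> T = S - {m} then (-1) ^ card {j\<in>S. j < m} else 0)"
  by (simp add: fcre_def fadj_def fann_def)

lemma fmul_fcre:
  assumes "S \<subseteq> {..<M}"
  shows "fmul M (fcre m) B S U =
    (if m \<in> S then (-1) ^ card {j\<in>S. j < m} * B (S - {m}) U else 0)"
proof -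
  have "fmul M (fcre m) B S U = (\<Sum>T\<in>Pow {..<M}.
      if T = S - {m} then (if m \<in> S then (-1) ^ card {j\<in>S. j < m} * B T U else 0) else 0)"
    unfolding fmul_def by (intro sum.cong) (auto simp: fcre_apply)
  then show ?thesis
    using assms by (auto simp: sum.delta')
qed

lemma card_below_insert:
  assumes "finite S" "m \<notin> S"
  shows "card {j \<in> insert m S. j < n} = card {j \<in> S. j < n} + (if m < n then 1 else 0)"
proof -
  have "{j \<in> insert m S. j < n} =
      (if m < n then insert m {j \<in> S. j < n} else {j \<in> S. j < n})"
    by auto
  with assms show ?thesis by simp
qed

lemma card_below_remove:
  assumes "finite S" "m \<in> S"
  shows "card {j \<in> S. j < n} = card {j \<in> S - {m}. j < n} + (if m < n then 1 else 0)"
  using card_below_insert[of "S - {m}" m n] assms by (simp add: insert_absorb)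

text \<open>Removing the smaller of the two modes first lowers by one the count of modes below the
  larger; removing the larger first does not affect the smaller. This one unit is the sign.\<close>

lemma anticommute_fcre_fcre:
  assumes "S \<subseteq> {..<M}"
  shows "fmul M (fcre m) (fcre n) S U = - fmul M (fcre n) (fcre m) S U"
proof (cases "m \<in> S \<and> n \<in> S \<and> m \<noteq> n")
  case True
  have "finite S" using assms finite_subset by blast
  moreover have "S - {m} - {n} = S - {n} - {m}" by blast
  ultimately show ?thesis
    using True assms card_below_remove[of S m n] card_below_remove[of S n m]
    by (cases "m < n") (simp_all add: fmul_fcre fcre_apply)
next
  case False
  with assms show ?thesis by (auto simp: fmul_fcre fcre_apply)
qed

lemma minus_one_power_sq [simp]: "(-1::complex) ^ n * (-1) ^ n = 1"
  by (simp add: power_mult_distrib[symmetric])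

lemma number_op_apply:
  assumes "S \<subseteq> {..<M}"
  shows "fmul M (fcre m) (fann m) S U = (if S = U \<and> m \<in> S then 1 else 0)"
proof (cases "m \<in> S")
  case True
  then have "{j \<in> S. j \<noteq> m \<and> j < m} = {j \<in> S. j < m}" by auto
  with True assms show ?thesis
    by (cases "S = U") (auto simp: fmul_fcre fann_apply insert_absorb)
qed (use assms in \<open>simp add: fmul_fcre\<close>)

lemma vacancy_op_apply:
  assumes "S \<subseteq> {..<M}" "m < M"
  shows "fmul M (fann m) (fcre m) S U = (if S = U \<and> m \<notin> S then 1 else 0)"
proof (cases "m \<in> S")
  case False
  then have "{j \<in> insert m S. j < m} = {j \<in> S. j < m}" by auto
  with False assms show ?thesis by (auto simp: fmul_fann fcre_apply)
qed (use assms in \<open>simp add: fmul_fann\<close>)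

lemma anticommute_fann_fcre:
  assumes "S \<subseteq> {..<M}" "m < M"
  shows "fmul M (fann m) (fcre n) S U =
    (if m = n then fid S U else 0) - fmul M (fcre n) (fann m) S U"
proof (cases "m = n")
  case True
  then show ?thesis
    using assms by (simp add: number_op_apply vacancy_op_apply fid_def)
next
  case False
  show ?thesis
  proof (cases "m \<notin> S \<and> n \<in> S")
    case True
    have "finite S" using assms finite_subset by blast
    moreover have "insert m S - {n} = insert m (S - {n})" using \<open>m \<noteq> n\<close> by blast
    ultimately show ?thesis
      using True \<open>m \<noteq> n\<close> assms card_below_insert[of S m n] card_below_remove[of S n m]
      by (cases "m < n") (simp_all add: fmul_fcre fmul_fann fcre_apply fann_apply)
  next
    case False
    with \<open>m \<noteq> n\<close> assms show ?thesis
      by (auto simp: fmul_fcre fmul_fann fcre_apply fann_apply)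
  qed
qed

lemma exp_i_pi_times_nat: "exp (\<i> * complex_of_real pi * of_nat n) = (-1) ^ n"
  by (metis exp_of_nat_mult exp_pi_i mult.commute)

lemma parity_h_apply:
  assumes "S \<subseteq> {..<L}" "U \<subseteq> {..<L}"
  shows "parity_h L S U = (if S = U then (-1) ^ card S else 0)"
proof -
  have "fscale (\<i> * pi) (fsum {..<L} (\<lambda>i. fmul L (fcre i) (fann i))) S U =
      (if S = U then \<i> * complex_of_real pi * of_nat (card S) else 0)" if S: "S \<subseteq> {..<L}" for S U
  proof -
    have "(\<Sum>i<L. if i \<in> S then 1 else 0) = complex_of_nat (card S)"
      using S by (simp add: sum.If_cases Int_absorb1)
    with S show ?thesis
      by (auto simp: fscale_def fsum_def number_op_apply)
  qed
  then show ?thesis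
    unfolding parity_h_def using assms by (subst fexp_diag) (auto simp: exp_i_pi_times_nat)
qed

section \<open>Time slices\<close>

abbreviation slice :: "nat \<Rightarrow> nat \<Rightarrow> nat set" where
  "slice L t \<equiv> {t * L..<t * L + L}"

text \<open>Mode numbers grow with the slice, so this is the set of particles on slices earlier than
  \<open>t\<close>, which is what a Jordan-Wigner sign on slice \<open>t\<close> sees outside its
  own slice.\<close>

definition before :: "nat \<Rightarrow> nat \<Rightarrow> nat set \<Rightarrow> nat set" where
  "before L t S = {j \<in> S. j < t * L}"

definition at_slice :: "nat \<Rightarrow> nat \<Rightarrow> nat set \<Rightarrow> nat set" where
  "at_slice L t S = {i. i < L \<and> slot L t i \<in> S}"

text \<open>Together with \<open>at_slice\<close> this parametrizes the states that agree with
  \<open>S\<close> off slice \<open>t\<close>; these are the only ones that an operator placed on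
  that slice connects with \<open>S\<close>.\<close>

definition put_slice :: "nat \<Rightarrow> nat \<Rightarrow> nat set \<Rightarrow> nat set \<Rightarrow> nat set" where
  "put_slice L t S R = (S - slice L t) \<union> slot L t ` R"

lemma slice_bound: "t < N \<Longrightarrow> t * L + L \<le> L * (N::nat)"
  by (metis Suc_leI add.commute mult.commute mult_Suc mult_le_mono1)

lemma inj_slot: "inj_on (slot L t) A"
  by (simp add: inj_on_def slot_def)

lemma slice_eq_image: "slice L t = slot L t ` {..<L}"
proof -
  have "x \<in> slot L t ` {..<L}" if "x \<in> slice L t" for x
    using that by (intro image_eqI[of _ _ "x - t * L"]) (auto simp: slot_def)
  then show ?thesis by (auto simp: slot_def)
qed

lemma slot_at_slice: "slot L t ` at_slice L t S = S \<inter> slice L t"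
  by (auto simp: at_slice_def slice_eq_image slot_def)

lemma at_slice_subset [simp]: "at_slice L t S \<subseteq> {..<L}"
  by (auto simp: at_slice_def)

lemma finite_at_slice [simp]: "finite (at_slice L t S)"
  by (rule finite_subset[OF at_slice_subset]) simp

lemma at_slice_eq_iff: "at_slice L t S = at_slice L t U \<longleftrightarrow> S \<inter> slice L t = U \<inter> slice L t"
  by (metis slot_at_slice inj_slot[of L t UNIV] inj_image_eq_iff)

lemma put_slice_subset:
  assumes "S \<subseteq> {..<L * N}" "R \<subseteq> {..<L}" "t < N"
  shows "put_slice L t S R \<subseteq> {..<L * N}"
  using assms slice_bound[OF assms(3), of L] by (auto simp: put_slice_def slot_def)

lemma put_slice_diff: "R \<subseteq> {..<L} \<Longrightarrow> put_slice L t S R - slice L t = S - slice L t"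
  by (auto simp: put_slice_def slot_def)

lemma at_put_slice: "R \<subseteq> {..<L} \<Longrightarrow> at_slice L t (put_slice L t S R) = R"
  by (auto simp: put_slice_def at_slice_def slot_def)

lemma slices_disjoint: "s < t \<Longrightarrow> s * L + L \<le> t * (L::nat)"
  by (metis Suc_leI add.commute mult_Suc mult_le_mono1)

lemma at_slice_cong_outside:
  assumes "S - slice L t = U - slice L t" "s \<noteq> t"
  shows "at_slice L s S = at_slice L s U"
proof -
  have "slot L s i \<notin> slice L t" if "i < L" for i
    using that assms(2) slices_disjoint[of s t L] slices_disjoint[of t s L]
    by (cases s t rule: linorder_cases) (auto simp: slot_def)
  then have "slot L s i \<in> S \<longleftrightarrow> slot L s i \<in> U" if "i < L" for i
    using assms(1) that by blast
  then show ?thesis by (auto simp: at_slice_def)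
qed

lemma before_cong_outside:
  assumes "S - slice L t = U - slice L t" "s \<le> t"
  shows "before L s S = before L s U"
proof -
  have "j \<notin> slice L t" if "j < s * L" for j
  proof -
    have "s * L \<le> t * L" using assms(2) by (rule mult_le_mono1)
    with that have "j < t * L" by linarith
    then show ?thesis by simp
  qed
  with assms(1) show ?thesis unfolding before_def by blast
qed

lemma put_slice_self:
  assumes "S - slice L t = U - slice L t"
  shows "put_slice L t S (at_slice L t U) = U"
  unfolding put_slice_def slot_at_slice assms by blast

text \<open>\<open>put_slice\<close> and \<open>at_slice\<close> are mutually inverse on the states
  agreeing with \<open>S\<close> off the slice. A matrix product on the big space thereby turns into
  one on the small space.\<close>

lemma sum_over_slice:
  fixes f :: "nat set \<Rightarrow> complex"
  assumes "S \<subseteq> {..<L * N}" "t < N"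
  shows "(\<Sum>T\<in>Pow {..<L * N}. if S - slice L t = T - slice L t then f T else 0) =
    (\<Sum>R\<in>Pow {..<L}. f (put_slice L t S R))"
proof -
  have "(\<Sum>T\<in>Pow {..<L * N}. if S - slice L t = T - slice L t then f T else 0) =
      (\<Sum>T\<in>{T \<in> Pow {..<L * N}. S - slice L t = T - slice L t}. f T)"
    by (rule sum.inter_filter[symmetric]) simp
  also have "\<dots> = (\<Sum>R\<in>Pow {..<L}. f (put_slice L t S R))"
    by (rule sum.reindex_bij_witness[of _ "put_slice L t S" "at_slice L t"])
      (use assms in \<open>auto simp: put_slice_self put_slice_diff at_put_slice
         dest: subsetD[OF at_slice_subset] subsetD[OF put_slice_subset]\<close>)
  finally show ?thesis .
qed

section \<open>Operators placed on a slice\<close>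

text \<open>Read along rows, each creator removes the smallest mode left on the slice, so its sign
  counts earlier slices only. The condition on \<open>B\<close>, provided later by the vacancy
  projector, kills every row in which \<open>ms\<close> does not exhaust the slice.\<close>

lemma foldr_fcre_apply:
  assumes "sorted_wrt (<) ms" "set ms \<subseteq> slice L t"
    and "\<And>V. V \<subseteq> {..<M} \<Longrightarrow> V \<inter> slice L t \<noteq> {} \<Longrightarrow> B V U = 0" and "S \<subseteq> {..<M}"
  shows "foldr (fmul M) (map fcre ms) B S U =
    (if S \<inter> slice L t = set ms
     then (-1) ^ (card (before L t S) * length ms) * B (S - slice L t) U else 0)"
  using assms
proof (induction ms arbitrary: S)
  case Nil
  then show ?case by (auto simp: Diff_triv)
next
  case (Cons m ms)
  show ?case
  proof (cases "m \<in> S")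
    case False
    with Cons.prems show ?thesis by (auto simp: fmul_fcre)
  next
    case True
    have m: "m \<in> slice L t" "m \<notin> set ms" using Cons.prems by auto
    have e1: "(S - {m}) \<inter> slice L t = set ms \<longleftrightarrow> S \<inter> slice L t = set (m # ms)"
      using True m unfolding list.set by blast
    have e2: "before L t (S - {m}) = before L t S"
      using m by (auto simp: before_def)
    have e3: "S - {m} - slice L t = S - slice L t"
      using m by blast
    have IH: "foldr (fmul M) (map fcre ms) B (S - {m}) U =
        (if S \<inter> slice L t = set (m # ms)
         then (-1) ^ (card (before L t S) * length ms) * B (S - slice L t) U else 0)"
      unfolding e1[symmetric] e2[symmetric] e3[symmetric]
      by (rule Cons.IH) (use Cons.prems in auto)
    have "{j \<in> S. j < m} = before L t S" if "S \<inter> slice L t = set (m # ms)"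
    proof -
      have m': "t * L \<le> m" "m < t * L + L" using m by simp_all
      have "\<not> j < m" if "j \<in> S \<inter> slice L t" for j
        using that Cons.prems(1) unfolding \<open>S \<inter> slice L t = set (m # ms)\<close> by auto
      then have "j < t * L" if "j \<in> S" "j < m" for j
        using that m' by (meson IntI atLeastLessThan_iff less_trans not_le_imp_less)
      then show ?thesis
        using m' by (auto simp: before_def)
    qed
    then show ?thesis
      using True Cons.prems(4) IH
      by (cases "S \<inter> slice L t = set (m # ms)") (simp_all add: fmul_fcre power_add)
  qed
qed

lemma foldr_vacancy_apply:
  assumes "set ms \<subseteq> {..<M}" "S \<subseteq> {..<M}"
  shows "foldr (fmul M) (map (\<lambda>m. fmul M (fann m) (fcre m)) ms) B S U =
    (if S \<inter> set ms = {} then B S U else 0)"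
  using assms
proof (induction ms)
  case (Cons m ms)
  have "fmul M (fmul M (fann m) (fcre m)) C S U = (if m \<notin> S then C S U else 0)" for C
  proof -
    have "fmul M (fmul M (fann m) (fcre m)) C S U =
        fmul M (\<lambda>S' U. if m \<notin> S then fid S' U else 0) C S U"
      using Cons.prems by (intro fmul_cong) (auto simp: vacancy_op_apply fid_def)
    also have "\<dots> = (if m \<notin> S then C S U else 0)"
      using Cons.prems(2) fmul_fid_left[of S M C U]
      by (cases "m \<in> S") (simp_all add: fmul_def)
    finally show ?thesis .
  qed
  with Cons show ?case by simp
qed simp

text \<open>Mirror image of the creators: each annihilator adds a mode below all those already
  present on the slice, so again only earlier slices enter the sign.\<close>

lemma foldr_fann_apply:
  assumes "sorted_wrt (>) ms" "set ms \<subseteq> slice L t" "slice L t \<subseteq> {..<M}"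
    and "\<And>m j. m \<in> set ms \<Longrightarrow> j \<in> S \<inter> slice L t \<Longrightarrow> m < j" and "S \<subseteq> {..<M}"
  shows "foldr (fmul M) (map fann ms) B S U =
    (-1) ^ (card (before L t S) * length ms) * B (S \<union> set ms) U"
  using assms
proof (induction ms arbitrary: S)
  case (Cons m ms)
  have m: "m \<in> slice L t" "m < M" "m \<notin> S" using Cons.prems by auto
  have "{j \<in> S. j < m} = before L t S"
    using m Cons.prems(4)[of m] by (fastforce simp: before_def)
  moreover have "before L t (insert m S) = before L t S"
    using m by (auto simp: before_def)
  moreover have "foldr (fmul M) (map fann ms) B (insert m S) U =
      (-1) ^ (card (before L t (insert m S)) * length ms) * B (insert m S \<union> set ms) U"
    by (rule Cons.IH) (use Cons.prems m in auto)
  ultimately show ?case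
    using Cons.prems m by (simp add: fmul_fann power_add)
qed simp

text \<open>In the expansion into monomials the creators force \<open>S'\<close> to be the content
  of the row on the slice, the vacancy projector demands an empty slice, and the annihilators force
  \<open>U'\<close>. Each of the \<open>card S' + card U'\<close> ladder operators brings one factor
  \<open>(-1) ^ card (before L t S)\<close>, while the vacancy pairs bring none. All further
  properties of placed operators are read off this formula.\<close>

lemma emb_apply:
  assumes t: "t < N" and S: "S \<subseteq> {..<L * N}" and U: "U \<subseteq> {..<L * N}"
  shows "emb L N t A S U =
    (if S - slice L t = U - slice L t
     then (-1) ^ (card (before L t S) * (card (at_slice L t S) + card (at_slice L t U)))
       * A (at_slice L t S) (at_slice L t U) else 0)"
proof -
  let ?M = "L * N"
  have sl: "slice L t \<subseteq> {..<?M}"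
    using slice_bound[OF t, of L] by auto
  have entry: "fprod ?M
       (map (\<lambda>i. fcre (slot L t i)) (sorted_list_of_set S')
        @ map (\<lambda>i. fmul ?M (fann (slot L t i)) (fcre (slot L t i))) [0..<L]
        @ map (\<lambda>i. fann (slot L t i)) (rev (sorted_list_of_set U'))) S U =
     (if S' = at_slice L t S \<and> U' = at_slice L t U \<and> S - slice L t = U - slice L t
      then (-1) ^ (card (before L t S) * (card S' + card U')) else 0)"
    if S': "S' \<subseteq> {..<L}" and U': "U' \<subseteq> {..<L}" for S' U'
  proof -
    have fin: "finite S'" "finite U'" using S' U' finite_subset by blast+
    define C where "C = foldr (fmul ?M) (map fann (map (slot L t) (rev (sorted_list_of_set U')))) fid"
    define B where "B = foldr (fmul ?M)
      (map (\<lambda>m. fmul ?M (fann m) (fcre m)) (map (slot L t) [0..<L])) C"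
    have C: "C V U = (-1) ^ (card (before L t V) * card U') * fid (V \<union> slot L t ` U') U"
      if "V \<subseteq> {..<?M}" "V \<inter> slice L t = {}" for V
    proof -
      have "set (map (slot L t) (rev (sorted_list_of_set U'))) \<subseteq> slice L t"
        using U' fin by (auto simp: slot_def)
      moreover have "sorted_wrt (>) (map (slot L t) (rev (sorted_list_of_set U')))"
        by (simp add: sorted_wrt_map sorted_wrt_rev slot_def)
      ultimately show ?thesis
        unfolding C_def using that sl fin by (subst foldr_fann_apply[where L = L and t = t]) auto
    qed
    have B: "B V U = (if V \<inter> slice L t = {} then C V U else 0)" if "V \<subseteq> {..<?M}" for V
      unfolding B_def using that sl
      by (subst foldr_vacancy_apply) (auto simp: slice_eq_image lessThan_atLeast0)
    have f1: "foldr (fmul ?M) (map fcre (map (slot L t) (sorted_list_of_set S'))) B S U =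
      (if S \<inter> slice L t = slot L t ` S'
       then (-1) ^ (card (before L t S) * card S') * B (S - slice L t) U else 0)"
    proof -
      have "set (map (slot L t) (sorted_list_of_set S')) \<subseteq> slice L t"
        using S' fin by (auto simp: slot_def)
      moreover have "sorted_wrt (<) (map (slot L t) (sorted_list_of_set S'))"
        by (simp add: sorted_wrt_map slot_def)
      ultimately show ?thesis
        using S B fin by (subst foldr_fcre_apply[where L = L and t = t]) auto
    qed
    have f2: "B (S - slice L t) U =
        (-1) ^ (card (before L t S) * card U') * fid ((S - slice L t) \<union> slot L t ` U') U"
    proof -
      have "before L t (S - slice L t) = before L t S"
        by (auto simp: before_def)
      then show ?thesis
        using S B[of "S - slice L t"] C[of "S - slice L t"] by (auto simp: Diff_Int_distrib2)
    qed
    have f3: "S \<inter> slice L t = slot L t ` S' \<longleftrightarrow> S' = at_slice L t S"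
      by (metis slot_at_slice inj_slot[of L t UNIV] inj_image_eq_iff)
    have f4: "(S - slice L t) \<union> slot L t ` U' = U \<longleftrightarrow>
        U' = at_slice L t U \<and> S - slice L t = U - slice L t"
      by (metis U' at_put_slice put_slice_def put_slice_diff put_slice_self)
    have f5: "fprod ?M
       (map (\<lambda>i. fcre (slot L t i)) (sorted_list_of_set S')
        @ map (\<lambda>i. fmul ?M (fann (slot L t i)) (fcre (slot L t i))) [0..<L]
        @ map (\<lambda>i. fann (slot L t i)) (rev (sorted_list_of_set U'))) =
       foldr (fmul ?M) (map fcre (map (slot L t) (sorted_list_of_set S'))) B"
      by (simp add: fprod_def B_def C_def o_def rev_map)
    show ?thesis
      unfolding f5 f1 f2 f3 fid_def f4 by (simp add: power_add distrib_left)
  qed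
  have "emb L N t A S U = (\<Sum>x\<in>Pow {..<L} \<times> Pow {..<L}. if x = (at_slice L t S, at_slice L t U)
     then (if S - slice L t = U - slice L t
       then (-1) ^ (card (before L t S) * (card (at_slice L t S) + card (at_slice L t U)))
         * A (at_slice L t S) (at_slice L t U) else 0) else 0)"
    unfolding emb_def fsum_def
  proof (rule sum.cong[OF refl])
    fix x assume "x \<in> Pow {..<L} \<times> Pow {..<L}"
    then obtain S' U' where x: "x = (S', U')" "S' \<subseteq> {..<L}" "U' \<subseteq> {..<L}" by auto
    show "(case x of (S', U') \<Rightarrow> fscale (A S' U') (fprod ?M
       (map (\<lambda>i. fcre (slot L t i)) (sorted_list_of_set S')
        @ map (\<lambda>i. fmul ?M (fann (slot L t i)) (fcre (slot L t i))) [0..<L]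
        @ map (\<lambda>i. fann (slot L t i)) (rev (sorted_list_of_set U'))))) S U =
     (if x = (at_slice L t S, at_slice L t U)
     then (if S - slice L t = U - slice L t
       then (-1) ^ (card (before L t S) * (card (at_slice L t S) + card (at_slice L t U)))
         * A (at_slice L t S) (at_slice L t U) else 0) else 0)"
      using entry[OF x(2,3)] by (simp add: x(1) fscale_def)
  qed
  then show ?thesis by simp
qed

lemma minus_one_power_chain:
  "(-1::complex) ^ (c * (a + b)) * (-1) ^ (c * (b + d)) = (-1) ^ (c * (a + d))"
  by (auto simp: minus_one_power_iff)

text \<open>The particles on earlier slices are the same in all three states, and the occupation of
  the intermediate one enters the exponent twice, so the signs chain.\<close>

lemma emb_fmul:
  assumes "t < N"
  shows "fres (L * N) (fmul (L * N) (emb L N t A) (emb L N t B)) = fres (L * N) (emb L N t (fmul L A B))"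
proof (rule fres_eqI)
  fix S U assume S: "S \<subseteq> {..<L * N}" and U: "U \<subseteq> {..<L * N}"
  let ?s = "\<lambda>S U. (-1) ^ (card (before L t S) * (card (at_slice L t S) + card (at_slice L t U)))"
  have "fmul (L * N) (emb L N t A) (emb L N t B) S U =
      (\<Sum>T\<in>Pow {..<L * N}. if S - slice L t = T - slice L t
        then (?s S T * A (at_slice L t S) (at_slice L t T)) * emb L N t B T U else 0)"
    unfolding fmul_def using S assms by (intro sum.cong) (auto simp: emb_apply)
  also have "\<dots> = (\<Sum>R\<in>Pow {..<L}. (?s S (put_slice L t S R) *
      A (at_slice L t S) (at_slice L t (put_slice L t S R))) * emb L N t B (put_slice L t S R) U)"
    by (rule sum_over_slice[OF S assms])
  also have "\<dots> = (\<Sum>R\<in>Pow {..<L}. if S - slice L t = U - slice L t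
      then ?s S U * (A (at_slice L t S) R * B R (at_slice L t U)) else 0)"
  proof (rule sum.cong[OF refl])
    fix R assume "R \<in> Pow {..<L}"
    then have R: "R \<subseteq> {..<L}" by simp
    have b: "before L t (put_slice L t S R) = before L t S"
      by (rule before_cong_outside[OF put_slice_diff[OF R]]) simp
    show "(?s S (put_slice L t S R) *
      A (at_slice L t S) (at_slice L t (put_slice L t S R))) * emb L N t B (put_slice L t S R) U =
      (if S - slice L t = U - slice L t
      then ?s S U * (A (at_slice L t S) R * B R (at_slice L t U)) else 0)"
      using emb_apply[OF assms put_slice_subset[OF S R assms] U, of B]
        minus_one_power_chain[of "card (before L t S)" "card (at_slice L t S)" "card R"
          "card (at_slice L t U)"]
      by (simp add: put_slice_diff[OF R] at_put_slice[OF R] b)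
  qed
  also have "\<dots> = emb L N t (fmul L A B) S U"
    using S U assms by (simp add: emb_apply fmul_def sum_distrib_left)
  finally show "fmul (L * N) (emb L N t A) (emb L N t B) S U = emb L N t (fmul L A B) S U" .
qed

lemma emb_fid:
  assumes "t < N"
  shows "fres (L * N) (emb L N t fid) = fone (L * N)"
  unfolding fone_def
proof (rule fres_eqI)
  fix S U assume S: "S \<subseteq> {..<L * N}" and U: "U \<subseteq> {..<L * N}"
  have "S = U \<longleftrightarrow> S - slice L t = U - slice L t \<and> at_slice L t S = at_slice L t U"
    by (metis put_slice_self)
  moreover have "(-1::complex) ^ (c * (a + a)) = 1" for a c :: nat
    by (metis minus_one_power_sq distrib_left power_add)
  ultimately show "emb L N t fid S U = fid S U"
    using S U assms by (auto simp: emb_apply fid_def)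
qed

lemma emb_cong:
  assumes "t < N" "fres L A = fres L B"
  shows "fres (L * N) (emb L N t A) = fres (L * N) (emb L N t B)"
  using assms(1) by (intro fres_eqI) (simp add: emb_apply fres_eqD[OF assms(2)])

lemma fpow_emb:
  assumes "t < N"
  shows "fres (L * N) (fpow (L * N) (emb L N t A) n) = fres (L * N) (emb L N t (fpow L A n))"
proof (induction n)
  case 0
  then show ?case using emb_fid[OF assms] by (simp add: fone_def)
next
  case (Suc n)
  then show ?case using emb_fmul[OF assms, of L A] by (simp add: fres_fmul)
qed

lemma emb_fscale:
  "emb L N t (fscale c A) = fscale c (emb L N t A)"
  by (intro ext) (simp add: emb_def fscale_def fsum_def sum_distrib_left mult.assoc case_prod_unfold)

text \<open>Powers pass through \<open>emb\<close> by multiplicativity. For fixed row and column the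
  sign is the same in every term, so the series can be summed on the small space.\<close>

lemma fexp_emb:
  assumes "t < N"
  shows "fres (L * N) (fexp (L * N) (emb L N t A)) = fres (L * N) (emb L N t (fexp L A))"
proof (rule fres_eqI)
  fix S U assume S: "S \<subseteq> {..<L * N}" and U: "U \<subseteq> {..<L * N}"
  let ?s = "(-1) ^ (card (before L t S) * (card (at_slice L t S) + card (at_slice L t U)))"
  have "fpow (L * N) (emb L N t A) n S U / of_nat (fact n) = (if S - slice L t = U - slice L t
      then ?s * (fpow L A n (at_slice L t S) (at_slice L t U) / of_nat (fact n)) else 0)" for n
    using fres_eqD[OF fpow_emb[OF assms] S U, of A n] S U assms by (simp add: emb_apply)
  moreover have "(\<lambda>n. ?s * (fpow L A n (at_slice L t S) (at_slice L t U) / of_nat (fact n))) sums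
      (?s * fexp L A (at_slice L t S) (at_slice L t U))"
    by (intro sums_mult fexp_sums) simp
  ultimately show "fexp (L * N) (emb L N t A) S U = emb L N t (fexp L A) S U"
    using S U assms
    by (cases "S - slice L t = U - slice L t") (auto simp: emb_apply fexp_def sums_iff)
qed

text \<open>Definite parity read off the matrix: \<open>p = False\<close> means even,
  \<open>p = True\<close> odd, and the zero operator is both.\<close>

definition homogeneous :: "nat \<Rightarrow> bool \<Rightarrow> fop \<Rightarrow> bool" where
  "homogeneous L p A \<longleftrightarrow>
    (\<forall>S\<subseteq>{..<L}. \<forall>U\<subseteq>{..<L}. A S U \<noteq> 0 \<longrightarrow> odd (card S + card U) = p)"

text \<open>Only slice \<open>s\<close> differs, so the particle number before a later slice changes
  exactly by the change on \<open>s\<close>. The additive form avoids subtraction of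
  naturals.\<close>

lemma card_before_change:
  assumes "s < t" "finite S" "finite U" "S - slice L s = U - slice L s"
  shows "card (before L t S) + card (at_slice L s U) = card (before L t U) + card (at_slice L s S)"
proof -
  have *: "card (before L t S) = card (before L t (S - slice L s)) + card (at_slice L s S)"
    if "finite S" for S
  proof -
    have "before L t S = before L t (S - slice L s) \<union> (S \<inter> slice L s)"
      using slices_disjoint[OF assms(1), of L] by (auto simp: before_def)
    moreover have "before L t (S - slice L s) \<inter> (S \<inter> slice L s) = {}"
      by (auto simp: before_def)
    moreover have "card (S \<inter> slice L s) = card (at_slice L s S)"
      by (metis slot_at_slice card_image inj_slot)
    moreover have "finite (before L t (S - slice L s))"
      using that by (simp add: before_def)
    ultimately show ?thesis
      using that card_Un_disjoint by (metis finite_Int)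
  qed
  show ?thesis
    using *[OF assms(2)] *[OF assms(3)] assms(4) by simp
qed

text \<open>Both orders admit a single intermediate state and the same two matrix entries. The
  earlier slice does not notice the later one; the sign of \<open>B\<close> does depend on whether
  \<open>A\<close> has already changed the particle number before slice \<open>t\<close>.\<close>

lemma emb_graded_commute_less:
  assumes st: "s < t" and t: "t < N" and A: "homogeneous L p A" and B: "homogeneous L q B"
    and S: "S \<subseteq> {..<L * N}" and U: "U \<subseteq> {..<L * N}"
  shows "fmul (L * N) (emb L N s A) (emb L N t B) S U =
    (if p \<and> q then -1 else 1) * fmul (L * N) (emb L N t B) (emb L N s A) S U"
proof -
  have s: "s < N" using st t by simp
  have disj: "slice L s \<inter> slice L t = {}"
    using slices_disjoint[OF st, of L] by auto
  let ?a = "card (at_slice L s S)" and ?a' = "card (at_slice L s U)"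
  let ?b = "card (at_slice L t S)" and ?b' = "card (at_slice L t U)"
  have unique: "T = put_slice L r S (at_slice L r U)"
    if "S - slice L r = T - slice L r" "T - slice L r' = U - slice L r'"
      "slice L r \<inter> slice L r' = {}" for T r r'
  proof -
    have "T \<inter> slice L r = U \<inter> slice L r" using that(2,3) by blast
    then have "at_slice L r T = at_slice L r U" by (simp add: at_slice_eq_iff)
    then show ?thesis using put_slice_self[OF that(1)] by simp
  qed
  have prod: "fmul (L * N) (emb L N r X) (emb L N r' Y) S U =
      emb L N r X S (put_slice L r S (at_slice L r U)) * emb L N r' Y (put_slice L r S (at_slice L r U)) U"
    if "r < N" "r' < N" "slice L r \<inter> slice L r' = {}" for r r' X Y
  proof -
    have "fmul (L * N) (emb L N r X) (emb L N r' Y) S U =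
        (\<Sum>T\<in>Pow {..<L * N}. if T = put_slice L r S (at_slice L r U)
          then emb L N r X S T * emb L N r' Y T U else 0)"
      unfolding fmul_def
    proof (rule sum.cong[OF refl])
      fix T assume "T \<in> Pow {..<L * N}"
      then have T: "T \<subseteq> {..<L * N}" by simp
      have "emb L N r X S T * emb L N r' Y T U = 0" if "T \<noteq> put_slice L r S (at_slice L r U)"
      proof -
        have "S - slice L r \<noteq> T - slice L r \<or> T - slice L r' \<noteq> U - slice L r'"
          using that unique[of r T r'] \<open>slice L r \<inter> slice L r' = {}\<close> by blast
        then show ?thesis
          using emb_apply[OF \<open>r < N\<close> S T, of X] emb_apply[OF \<open>r' < N\<close> T U, of Y] by auto
      qed
      then show "emb L N r X S T * emb L N r' Y T U = (if T = put_slice L r S (at_slice L r U)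
          then emb L N r X S T * emb L N r' Y T U else 0)"
        by simp
    qed
    also have "\<dots> = emb L N r X S (put_slice L r S (at_slice L r U))
        * emb L N r' Y (put_slice L r S (at_slice L r U)) U"
      using put_slice_subset[OF S at_slice_subset that(1)] by simp
    finally show ?thesis .
  qed
  \<comment> \<open>The only possible intermediate states of the two orders: one slice already
    carries the content of \<open>U\<close>, everything else is still that of
    \<open>S\<close>.\<close>
  define V where "V = put_slice L s S (at_slice L s U)"
  define W where "W = put_slice L t S (at_slice L t U)"
  have V: "V \<subseteq> {..<L * N}" "V - slice L s = S - slice L s" "at_slice L s V = at_slice L s U"
    using S s by (simp_all add: V_def put_slice_subset put_slice_diff at_put_slice)
  have W: "W \<subseteq> {..<L * N}" "W - slice L t = S - slice L t" "at_slice L t W = at_slice L t U"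
    using S t by (simp_all add: W_def put_slice_subset put_slice_diff at_put_slice)
  have Vt: "at_slice L t V = at_slice L t S"
    using at_slice_cong_outside[OF V(2), of t] st by simp
  have Ws: "at_slice L s W = at_slice L s S" "before L s W = before L s S"
    using at_slice_cong_outside[OF W(2)] before_cong_outside[OF W(2), of s] st by auto
  have cond: "V - slice L t = U - slice L t \<longleftrightarrow> W - slice L s = U - slice L s"
  proof -
    have "V \<inter> slice L s = U \<inter> slice L s" "W \<inter> slice L t = U \<inter> slice L t"
      using V(3) W(3) by (simp_all add: at_slice_eq_iff)
    then show ?thesis using V(2) W(2) disj by blast
  qed
  have fin: "finite S" "finite V" using S V(1) finite_subset by blast+
  have bV: "card (before L t V) + ?a = card (before L t S) + ?a'"
    using card_before_change[OF st fin(2) fin(1) V(2)] by (simp add: V(3))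
  have lhs: "fmul (L * N) (emb L N s A) (emb L N t B) S U = (if V - slice L t = U - slice L t then
      (-1) ^ (card (before L s S) * (?a + ?a')) * (-1) ^ (card (before L t V) * (?b + ?b'))
      * (A (at_slice L s S) (at_slice L s U) * B (at_slice L t S) (at_slice L t U)) else 0)"
    unfolding prod[OF s t disj] V_def[symmetric]
    using emb_apply[OF s S V(1), of A] emb_apply[OF t V(1) U, of B] V Vt by simp
  have rhs: "fmul (L * N) (emb L N t B) (emb L N s A) S U = (if V - slice L t = U - slice L t then
      (-1) ^ (card (before L s S) * (?a + ?a')) * (-1) ^ (card (before L t S) * (?b + ?b'))
      * (A (at_slice L s S) (at_slice L s U) * B (at_slice L t S) (at_slice L t U)) else 0)"
    unfolding prod[OF t s disj[unfolded Int_commute[of "slice L s"]]] W_def[symmetric]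
    using emb_apply[OF t S W(1), of B] emb_apply[OF s W(1) U, of A] W Ws cond by simp
  show ?thesis
  proof (cases "A (at_slice L s S) (at_slice L s U) = 0 \<or> B (at_slice L t S) (at_slice L t U) = 0")
    case True
    then show ?thesis by (auto simp: lhs rhs)
  next
    case False
    then have "odd (?a + ?a') = p" "odd (?b + ?b') = q"
      using A B by (auto simp: homogeneous_def)
    moreover have "even (card (before L t V) + card (before L t S) + ?a + ?a')"
      using bV by presburger
    \<comment> \<open>The two counts before slice \<open>t\<close> differ by an odd number exactly
      if \<open>p\<close>, and this difference is multiplied by a number that is odd exactly if
      \<open>q\<close>.\<close>
    ultimately have "(-1::complex) ^ (card (before L t V) * (?b + ?b')) =
        (if p \<and> q then -1 else 1) * (-1) ^ (card (before L t S) * (?b + ?b'))"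
      by (auto simp: minus_one_power_iff)
    then show ?thesis by (simp add: lhs rhs)
  qed
qed

lemma emb_graded_commute:
  assumes "s \<noteq> t" "s < N" "t < N" "homogeneous L p A" "homogeneous L q B"
  shows "fmul (L * N) (fres (L * N) (emb L N s A)) (fres (L * N) (emb L N t B)) =
    fscale (if p \<and> q then -1 else 1)
      (fmul (L * N) (fres (L * N) (emb L N t B)) (fres (L * N) (emb L N s A)))"
  unfolding fres_fmul[symmetric] fres_fscale[symmetric]
proof (rule fres_eqI)
  fix S U assume SU: "S \<subseteq> {..<L * N}" "U \<subseteq> {..<L * N}"
  show "fmul (L * N) (emb L N s A) (emb L N t B) S U =
    fscale (if p \<and> q then -1 else 1) (fmul (L * N) (emb L N t B) (emb L N s A)) S U"
  proof (cases "s < t")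
    case True
    then show ?thesis
      using emb_graded_commute_less[OF True assms(3-5) SU] by (simp add: fscale_def)
  next
    case False
    with assms(1) have "t < s" by simp
    then show ?thesis
      using emb_graded_commute_less[OF \<open>t < s\<close> assms(2,5,4) SU] by (auto simp: fscale_def)
  qed
qed

section \<open>The time translation operator\<close>

lemma sum_roots_of_unity:
  fixes d :: int
  assumes "\<bar>d\<bar> < int N"
  shows "(\<Sum>k<N. cis (2 * pi * of_int d * real k / real N)) = (if d = 0 then of_nat N else 0)"
proof (cases "d = 0")
  case False
  have N: "N > 0" using assms by (cases N) auto
  define w where "w = cis (2 * pi * of_int d / real N)"
  have pw: "cis (2 * pi * of_int d * real k / real N) = w ^ k" for k
    unfolding w_def DeMoivre by (simp add: mult_ac)
  have "w \<noteq> 1"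
  proof
    assume "w = 1"
    then have "cos (2 * pi * of_int d / real N) = 1"
      by (simp add: w_def complex_eq_iff)
    then obtain n :: int where "2 * pi * of_int d / real N = of_int n * 2 * pi"
      unfolding cos_one_2pi_int by auto
    then have "of_int d = real_of_int (n * int N)"
      using N by (simp add: field_simps)
    then have d: "d = n * int N" by (simp only: of_int_eq_iff)
    with False have "\<bar>n\<bar> \<ge> 1" by auto
    then have "int N \<le> \<bar>n\<bar> * int N" using mult_right_mono[of 1 "\<bar>n\<bar>" "int N"] by simp
    then show False
      using assms by (simp add: d abs_mult)
  qed
  moreover have "w ^ N = 1"
  proof -
    have "w ^ N = cis (2 * pi * of_int d)"
      using N by (simp add: pw[symmetric])
    then show ?thesis by (simp add: cis_multiple_2pi)
  qed
  ultimately show ?thesis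
    using False unfolding pw by (simp add: sum_gp_strict)
qed simp

text \<open>This is \<open>e^{i \<omega>_n \<epsilon> t}\<close>; the step \<open>\<epsilon>\<close>
  cancels because \<open>T = \<epsilon> N\<close>.\<close>

definition phase :: "nat \<Rightarrow> nat \<Rightarrow> nat \<Rightarrow> complex" where
  "phase N n t = cis ((2 * real n + 1) * pi * real t / real N)"

lemma phase_omega:
  assumes "\<epsilon> > 0"
  shows "exp (\<i> * complex_of_real (omega \<epsilon> N n * \<epsilon> * real t)) = phase N n t"
proof -
  have "omega \<epsilon> N n * \<epsilon> * real t = (2 * real n + 1) * pi * real t / real N"
    using assms by (simp add: omega_def)
  then show ?thesis
    by (simp only: phase_def cis_conv_exp)
qed

lemma phase_Suc: "phase N n (Suc t) = phase N n 1 * phase N n t"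
  unfolding phase_def cis_mult by (simp add: add_divide_distrib algebra_simps)

lemma phase_0: "phase N n 0 = 1"
  by (simp add: phase_def)

text \<open>The exponent is the odd multiple \<open>2 n + 1\<close> of \<open>\<pi>\<close>,
  independently of the frequency label; this is the antiperiodicity in time.\<close>

lemma phase_period: "N > 0 \<Longrightarrow> phase N n N = -1"
proof -
  assume "N > 0"
  then have "phase N n N = cis pi ^ (2 * n + 1)"
    unfolding phase_def DeMoivre by (simp add: add.commute)
  then show ?thesis by simp
qed

lemma sum_phase_time:
  assumes "n < N" "m < N"
  shows "(\<Sum>t<N. phase N n t * cnj (phase N m t)) = (if n = m then of_nat N else 0)"
proof -
  have "phase N n t * cnj (phase N m t) =
      cis (2 * pi * of_int (int n - int m) * real t / real N)" for t
    unfolding phase_def cis_cnj cis_mult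
    by (rule arg_cong[of _ _ cis]) (simp add: diff_divide_distrib add_divide_distrib algebra_simps)
  then show ?thesis
    using sum_roots_of_unity[of "int n - int m" N] assms by simp
qed

lemma sum_phase_frequency:
  assumes "s < N" "t < N"
  shows "(\<Sum>n<N. phase N n t * cnj (phase N n s)) = (if s = t then of_nat N else 0)"
proof -
  \<comment> \<open>The half-integer shift of the frequencies produces the first factor, which does
    not depend on \<open>n\<close> and equals 1 for \<open>s = t\<close>; the second is an ordinary
    root of unity.\<close>
  have "phase N n t * cnj (phase N n s) = cis (pi * (real t - real s) / real N) *
      cis (2 * pi * of_int (int t - int s) * real n / real N)" for n
    unfolding phase_def cis_cnj cis_mult
    by (rule arg_cong[of _ _ cis]) (simp add: diff_divide_distrib add_divide_distrib algebra_simps)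
  then show ?thesis
    using sum_roots_of_unity[of "int t - int s" N] assms
    by (auto simp: sum_distrib_left[symmetric])
qed

lemma ahat_eq:
  assumes "\<epsilon> > 0"
  shows "ahat L N \<epsilon> n i = fsum {..<N} (\<lambda>t. fscale (phase N n t / sqrt (real N)) (fann (slot L t i)))"
  using phase_omega[OF assms] by (simp add: ahat_def fscale_def fsum_def sum_distrib_left)

lemma ahat_adj_eq:
  assumes "\<epsilon> > 0"
  shows "fadj (ahat L N \<epsilon> n i) =
    fsum {..<N} (\<lambda>t. fscale (cnj (phase N n t) / sqrt (real N)) (fcre (slot L t i)))"
  by (simp add: ahat_eq[OF assms] fadj_def fcre_def fscale_def fsum_def)

lemma slot_less: "t < N \<Longrightarrow> i < L \<Longrightarrow> slot L t i < L * N"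
  using slice_bound[of t N L] by (simp add: slot_def)

lemma slot_eq_iff:
  assumes "i < L" "j < L"
  shows "slot L s i = slot L t j \<longleftrightarrow> s = t \<and> i = j"
proof
  assume *: "slot L s i = slot L t j"
  have "slot L s i div L = s" "slot L t j div L = t"
    using assms by (simp_all add: slot_def)
  with * show "s = t \<and> i = j" by (simp add: slot_def)
qed simp

text \<open>Inverse discrete Fourier transform, obtained from orthogonality of the phases summed
  over frequencies.\<close>

lemma fcre_eq_sum_ahat_adj:
  assumes "\<epsilon> > 0" "t < N"
  shows "fcre (slot L t i) = fsum {..<N} (\<lambda>n. fscale (phase N n t / sqrt (real N)) (fadj (ahat L N \<epsilon> n i)))"
proof (intro ext)
  fix S U
  have N: "complex_of_real (sqrt (real N)) * complex_of_real (sqrt (real N)) = of_nat N"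
    by (simp flip: of_real_mult)
  have "fsum {..<N} (\<lambda>n. fscale (phase N n t / sqrt (real N)) (fadj (ahat L N \<epsilon> n i))) S U =
      (\<Sum>n<N. \<Sum>s<N. (phase N n t * cnj (phase N n s)) / of_nat N * fcre (slot L s i) S U)"
    by (simp add: ahat_adj_eq[OF assms(1)] fsum_def fscale_def sum_distrib_left N[symmetric] mult_ac)
  also have "\<dots> = (\<Sum>s<N. (\<Sum>n<N. phase N n t * cnj (phase N n s)) / of_nat N * fcre (slot L s i) S U)"
    by (subst sum.swap) (simp add: sum_distrib_right sum_divide_distrib)
  also have "\<dots> = (\<Sum>s<N. if s = t then fcre (slot L s i) S U else 0)"
    using assms by (intro sum.cong) (auto simp: sum_phase_frequency)
  also have "\<dots> = fcre (slot L t i) S U"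
    using assms by simp
  finally show "fcre (slot L t i) S U =
      fsum {..<N} (\<lambda>n. fscale (phase N n t / sqrt (real N)) (fadj (ahat L N \<epsilon> n i))) S U" ..
qed

section \<open>Anticommutation relations of the frequency modes\<close>

lemma fmul_lincomb:
  "fmul M (fsum I (\<lambda>t. fscale (a t) (A t))) (fsum J (\<lambda>s. fscale (b s) (B s))) S U =
    (\<Sum>t\<in>I. \<Sum>s\<in>J. a t * b s * fmul M (A t) (B s) S U)"
  by (simp add: fmul_fsum_left fmul_fsum_right fmul_fscale_left fmul_fscale_right)
    (simp add: fsum_def fscale_def sum_distrib_left mult_ac, rule sum.swap)

lemma anticommute_ahat_adj:
  assumes "\<epsilon> > 0" "S \<subseteq> {..<M}"
  shows "fmul M (fadj (ahat L N \<epsilon> n i)) (fadj (ahat L N \<epsilon> m j)) S U =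
    - fmul M (fadj (ahat L N \<epsilon> m j)) (fadj (ahat L N \<epsilon> n i)) S U"
  unfolding ahat_adj_eq[OF assms(1)] fmul_lincomb
  by (subst sum.swap, subst anticommute_fcre_fcre[OF assms(2)]) (simp add: sum_negf mult_ac)

lemma anticommute_ahat_ahat_adj:
  assumes "\<epsilon> > 0" "S \<subseteq> {..<L * N}" "i < L" "j < L" "n < N" "m < N"
  shows "fmul (L * N) (ahat L N \<epsilon> n i) (fadj (ahat L N \<epsilon> m j)) S U =
    (if n = m \<and> i = j then fid S U else 0)
    - fmul (L * N) (fadj (ahat L N \<epsilon> m j)) (ahat L N \<epsilon> n i) S U"
proof -
  have N: "complex_of_real (sqrt (real N)) * complex_of_real (sqrt (real N)) = of_nat N" "N > 0"
    using assms by (simp_all flip: of_real_mult)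
  let ?c = "\<lambda>t s. phase N n t / sqrt (real N) * (cnj (phase N m s) / sqrt (real N))"
  have "fmul (L * N) (ahat L N \<epsilon> n i) (fadj (ahat L N \<epsilon> m j)) S U =
      (\<Sum>t<N. \<Sum>s<N. ?c t s * fmul (L * N) (fann (slot L t i)) (fcre (slot L s j)) S U)"
    by (simp only: ahat_adj_eq[OF assms(1)]) (simp only: ahat_eq[OF assms(1)] fmul_lincomb)
  also have "\<dots> = (\<Sum>t<N. \<Sum>s<N. ?c t s * ((if s = t \<and> i = j then fid S U else 0)
      - fmul (L * N) (fcre (slot L s j)) (fann (slot L t i)) S U))"
    using assms by (intro sum.cong refl, subst anticommute_fann_fcre)
      (auto simp: slot_less slot_eq_iff)
  also have "\<dots> = (\<Sum>t<N. \<Sum>s<N. if s = t then (if i = j then ?c t s * fid S U else 0) else 0)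
      - (\<Sum>t<N. \<Sum>s<N. ?c t s * fmul (L * N) (fcre (slot L s j)) (fann (slot L t i)) S U)"
    unfolding sum_subtractf[symmetric] by (intro sum.cong refl) (auto simp: algebra_simps)
  also have "(\<Sum>t<N. \<Sum>s<N. if s = t then (if i = j then ?c t s * fid S U else 0) else 0) =
      (\<Sum>t<N. if i = j then ?c t t * fid S U else 0)"
    by (intro sum.cong refl) simp
  also have "\<dots> = (if i = j then (\<Sum>t<N. phase N n t * cnj (phase N m t)) / of_nat N * fid S U else 0)"
    by (simp add: N(1)[symmetric] sum_divide_distrib sum_distrib_right)
  also have "\<dots> = (if n = m \<and> i = j then fid S U else 0)"
    using assms N by (simp add: sum_phase_time)
  also have "(\<Sum>t<N. \<Sum>s<N. ?c t s * fmul (L * N) (fcre (slot L s j)) (fann (slot L t i)) S U) =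
      fmul (L * N) (fadj (ahat L N \<epsilon> m j)) (ahat L N \<epsilon> n i) S U"
    unfolding ahat_adj_eq[OF assms(1)] unfolding ahat_eq[OF assms(1)] fmul_lincomb
    by (subst sum.swap) (simp add: mult_ac)
  finally show ?thesis .
qed

text \<open>Moving a creator through a number operator meets an annihilator, leaving a delta term
  and a sign, and then another creator, giving a second sign. The signs cancel, so only the mode
  \<open>(n, i)\<close> contributes, with its frequency.\<close>

lemma momentum_commute:
  assumes "\<epsilon> > 0" "S \<subseteq> {..<L * N}" "U \<subseteq> {..<L * N}" "i < L" "n < N"
  shows "fmul (L * N) (momentum L N \<epsilon>) (fadj (ahat L N \<epsilon> n i)) S U =
    fmul (L * N) (fadj (ahat L N \<epsilon> n i)) (momentum L N \<epsilon>) S U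
    + of_real (omega \<epsilon> N n) * fadj (ahat L N \<epsilon> n i) S U"
proof -
  let ?M = "L * N"
  let ?a = "ahat L N \<epsilon>" and ?c = "\<lambda>n i. fadj (ahat L N \<epsilon> n i)"
  have number: "fmul ?M (fmul ?M (?c m j) (?a m j)) (?c n i) S U =
      fmul ?M (?c n i) (fmul ?M (?c m j) (?a m j)) S U + (if m = n \<and> j = i then ?c n i S U else 0)"
    if "m < N" "j < L" for m j
  proof -
    have "fmul ?M (fmul ?M (?c m j) (?a m j)) (?c n i) S U = fmul ?M (?c m j) (fmul ?M (?a m j) (?c n i)) S U"
      by (simp add: fmul_assoc)
    also have "\<dots> = fmul ?M (?c m j) (fadd (fscale (if m = n \<and> j = i then 1 else 0) fid)
        (fscale (-1) (fmul ?M (?c n i) (?a m j)))) S U"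
      using that assms by (intro fmul_cong)
        (auto simp: anticommute_ahat_ahat_adj fadd_def fscale_def)
    also have "\<dots> = (if m = n \<and> j = i then 1 else 0) * fmul ?M (?c m j) fid S U
        - fmul ?M (?c m j) (fmul ?M (?c n i) (?a m j)) S U"
      unfolding fmul_fadd_right fmul_fscale_right by (simp add: fadd_def fscale_def)
    also have "fmul ?M (?c m j) (fmul ?M (?c n i) (?a m j)) S U =
        fmul ?M (fscale (-1) (fmul ?M (?c n i) (?c m j))) (?a m j) S U"
      unfolding fmul_assoc[symmetric]
      using assms(2) by (intro fmul_cong)
        (simp_all add: anticommute_ahat_adj[OF assms(1), of _ _ _ _ m] fscale_def)
    also have "\<dots> = - fmul ?M (?c n i) (fmul ?M (?c m j) (?a m j)) S U"
      unfolding fmul_fscale_left fmul_assoc by (simp add: fscale_def)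
    finally show ?thesis
      using assms(3) by (auto simp: fmul_fid_right)
  qed
  have "fmul ?M (momentum L N \<epsilon>) (?c n i) S U = (\<Sum>(m, j)\<in>{..<N} \<times> {..<L}.
      of_real (omega \<epsilon> N m) * fmul ?M (fmul ?M (?c m j) (?a m j)) (?c n i) S U)"
    unfolding momentum_def fmul_fsum_left
    by (simp add: fsum_def case_prod_unfold fmul_fscale_left) (simp add: fscale_def)
  also have "\<dots> = (\<Sum>(m, j)\<in>{..<N} \<times> {..<L}.
      of_real (omega \<epsilon> N m) * fmul ?M (?c n i) (fmul ?M (?c m j) (?a m j)) S U)
      + (\<Sum>x\<in>{..<N} \<times> {..<L}. if x = (n, i) then of_real (omega \<epsilon> N n) * ?c n i S U else 0)"
    unfolding sum.distrib[symmetric] by (intro sum.cong) (auto simp: number distrib_left split: if_splits)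
  also have "(\<Sum>(m, j)\<in>{..<N} \<times> {..<L}.
      of_real (omega \<epsilon> N m) * fmul ?M (?c n i) (fmul ?M (?c m j) (?a m j)) S U) =
      fmul ?M (?c n i) (momentum L N \<epsilon>) S U"
    unfolding momentum_def fmul_fsum_right
    by (simp add: fsum_def case_prod_unfold fmul_fscale_right) (simp add: fscale_def)
  finally show ?thesis
    using assms by simp
qed

section \<open>The translation in the occupation basis\<close>

definition next_mode :: "nat \<Rightarrow> nat \<Rightarrow> nat \<Rightarrow> nat" where
  "next_mode L N m = (m + L) mod (L * N)"

lemma next_mode_slot:
  assumes "t < N" "i < L"
  shows "next_mode L N (slot L t i) = (if Suc t = N then slot L 0 i else slot L (Suc t) i)"
proof (cases "Suc t = N")
  case True
  then have "slot L t i + L = i + L * N"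
    by (auto simp: slot_def algebra_simps)
  moreover have "i < L * N" using assms slot_less[of 0 N i L] by (simp add: slot_def)
  ultimately have "next_mode L N (slot L t i) = i"
    by (simp only: next_mode_def mod_add_self2 mod_less)
  then show ?thesis
    using True by (simp add: slot_def)
next
  case False
  then have "slot L (Suc t) i < L * N" using assms by (intro slot_less) auto
  then show ?thesis
    using False by (simp add: next_mode_def slot_def algebra_simps)
qed

abbreviation translation :: "nat \<Rightarrow> nat \<Rightarrow> real \<Rightarrow> fop" where
  "translation L N \<epsilon> \<equiv> fexp (L * N) (fscale (\<i> * \<epsilon>) (momentum L N \<epsilon>))"

lemma translation_fcre:
  assumes "\<epsilon> > 0" "S \<subseteq> {..<L * N}" "U \<subseteq> {..<L * N}" "i < L" "t < N"
  shows "fmul (L * N) (translation L N \<epsilon>) (fcre (slot L t i)) S U =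
    (if Suc t = N then -1 else 1) *
    fmul (L * N) (fcre (next_mode L N (slot L t i))) (translation L N \<epsilon>) S U"
proof -
  let ?M = "L * N" and ?X = "translation L N \<epsilon>"
  let ?c = "\<lambda>n. fadj (ahat L N \<epsilon> n i)"
  let ?t = "if Suc t = N then 0 else Suc t"
  have N: "N > 0" "?t < N" using assms by auto
  have "fmul ?M ?X (fcre (slot L t i)) S U =
      (\<Sum>n<N. phase N n t / sqrt (real N) * fmul ?M ?X (?c n) S U)"
    unfolding fcre_eq_sum_ahat_adj[OF assms(1,5)] fmul_fsum_right fmul_fscale_right
    by (simp add: fsum_def fscale_def)
  also have "\<dots> = (\<Sum>n<N. phase N n (Suc t) / sqrt (real N) * fmul ?M (?c n) ?X S U)"
  proof (intro sum.cong refl)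
    fix n assume "n \<in> {..<N}"
    then have "fmul ?M ?X (?c n) S U =
        exp (\<i> * \<epsilon> * of_real (omega \<epsilon> N n)) * fmul ?M (?c n) ?X S U"
      using assms by (intro fexp_shift momentum_commute) auto
    also have "exp (\<i> * \<epsilon> * of_real (omega \<epsilon> N n)) = phase N n 1"
      using phase_omega[OF assms(1), of N n 1] by (simp add: mult_ac)
    finally show "phase N n t / sqrt (real N) * fmul ?M ?X (?c n) S U =
        phase N n (Suc t) / sqrt (real N) * fmul ?M (?c n) ?X S U"
      unfolding phase_Suc[of N n t] by simp
  qed
  also have "\<dots> = (if Suc t = N then -1 else 1) *
      (\<Sum>n<N. phase N n ?t / sqrt (real N) * fmul ?M (?c n) ?X S U)"
  proof -
    \<comment> \<open>On the last slice the phase becomes \<open>phase N n N = -1\<close>, while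
      slice 0 has phase 1, so the frequencies recombine to the creator on slice 0 with a
      sign.\<close>
    have "phase N n (Suc t) = (if Suc t = N then -1 else 1) * phase N n ?t" for n
      using phase_period[OF N(1)] by (simp add: phase_0)
    then show ?thesis
      unfolding sum_distrib_left by (intro sum.cong) auto
  qed
  also have "(\<Sum>n<N. phase N n ?t / sqrt (real N) * fmul ?M (?c n) ?X S U) =
      fmul ?M (fcre (slot L ?t i)) ?X S U"
    unfolding fcre_eq_sum_ahat_adj[OF assms(1) N(2)] fmul_fsum_left fmul_fscale_left
    by (simp add: fsum_def fscale_def)
  also have "slot L ?t i = next_mode L N (slot L t i)"
    using assms by (simp add: next_mode_slot)
  finally show ?thesis .
qed

text \<open>Every term of \<open>momentum\<close> ends in an annihilator and kills the vacuum, so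
  only the zeroth term of the exponential series survives.\<close>

lemma translation_vacuum:
  assumes "\<epsilon> > 0" "S \<subseteq> {..<L * N}"
  shows "translation L N \<epsilon> S {} = fid S {}"
proof -
  let ?M = "L * N"
  have mom: "momentum L N \<epsilon> T {} = 0" for T
    by (auto simp: momentum_def fsum_def fscale_def fmul_def ahat_def fann_def case_prod_unfold)
  have pw: "fpow ?M (momentum L N \<epsilon>) (Suc n) T {} = 0" for n T
  proof (induction n arbitrary: T)
    case 0
    then show ?case by (simp add: fmul_fid_right mom)
  next
    case (Suc n)
    then show ?case by (subst fpow.simps) (simp add: fmul_def)
  qed
  have "fpow ?M (fscale (\<i> * \<epsilon>) (momentum L N \<epsilon>)) n S {} / of_nat (fact n) =
      (if n = 0 then fid S {} else 0)" for n
    using pw[of "n - 1" S] by (cases n) (simp_all only: fpow_fscale, simp_all add: fscale_def)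
  then show ?thesis
    using sums_unique[OF sums_single[of 0 "\<lambda>_. fid S {}"]] by (simp add: fexp_def)
qed

lemma mode_cases:
  assumes "m < L * N"
  obtains t i where "t < N" "i < L" "m = slot L t i"
proof
  have L: "L > 0" using assms by (cases L) auto
  show "m div L < N" using assms L by (simp add: less_mult_imp_div_less mult.commute)
  show "m mod L < L" using L by simp
  show "m = slot L (m div L) (m mod L)" by (simp add: slot_def)
qed

lemma inj_on_next_mode: "inj_on (next_mode L N) {..<L * N}"
proof (rule inj_onI)
  fix m n assume mn: "m \<in> {..<L * N}" "n \<in> {..<L * N}" "next_mode L N m = next_mode L N n"
  obtain t i where t: "t < N" "i < L" "m = slot L t i" using mn mode_cases by blast
  obtain s j where s: "s < N" "j < L" "n = slot L s j" using mn mode_cases by blast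
  show "m = n"
    using mn(3) t s by (auto simp: next_mode_slot slot_eq_iff split: if_splits)
qed

lemma next_mode_less: "m < L * N \<Longrightarrow> next_mode L N m < L * N"
  unfolding next_mode_def by (rule mod_less_divisor) (cases "L * N", auto)

text \<open>Creation operators of the last slice wrap around to the first one, acquiring the sign of the
  antiperiodic frequencies, and then have to be moved past those of the other slices.\<close>

definition translation_sign :: "nat \<Rightarrow> nat \<Rightarrow> nat set \<Rightarrow> complex" where
  "translation_sign L N S =
    (-1) ^ (card (at_slice L (N - 1) S) * (1 + card (before L (N - 1) S)))"

text \<open>If the new smallest mode lies on the last slice, so does all of \<open>U\<close>;
  nothing is before it and only the wrap sign appears. Otherwise the number of modes before the last
  slice grows by one, which costs one sign per last-slice mode, and these are the modes that wrap to
  below the image of \<open>b\<close>.\<close>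

lemma translation_sign_insert:
  assumes b: "b < L * N" and U: "U \<subseteq> {..<L * N}" and less: "\<And>x. x \<in> U \<Longrightarrow> b < x"
  shows "translation_sign L N (insert b U) =
    (if b div L = N - 1 then -1 else 1) *
    (-1) ^ card {j \<in> insert (next_mode L N b) (next_mode L N ` U). j < next_mode L N b}
    * translation_sign L N U"
proof -
  obtain t i where t: "t < N" "i < L" "b = slot L t i" using mode_cases[OF b] .
  have div: "b div L = t" using t by (simp add: slot_def)
  have fin: "finite U" using U finite_subset by blast
  have bU: "b \<notin> U" using less by blast
  have img: "{j \<in> insert (next_mode L N b) (next_mode L N ` U). j < next_mode L N b} =
      next_mode L N ` {x \<in> U. next_mode L N x < next_mode L N b}" by auto
  have inj: "inj_on (next_mode L N) {x \<in> U. next_mode L N x < next_mode L N b}"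
    by (rule inj_on_subset[OF inj_on_next_mode]) (use U in auto)
  show ?thesis
  proof (cases "Suc t = N")
    case True
    then have t1: "t = N - 1" by simp
    have "before L t (insert b U) = {}"
      using less t by (fastforce simp: before_def slot_def)
    moreover have "before L t U = {}"
      using less t by (fastforce simp: before_def slot_def)
    moreover have "at_slice L t (insert b U) = insert i (at_slice L t U)" "i \<notin> at_slice L t U"
      using t bU by (auto simp: at_slice_def slot_eq_iff)
    moreover have "\<not> next_mode L N x < next_mode L N b" if x: "x \<in> U" for x
    proof -
      obtain s j where s: "s < N" "j < L" "x = slot L s j" using mode_cases U x by blast
      have "t \<le> s"
      proof (rule ccontr)
        assume "\<not> t \<le> s"
        then show False using slices_disjoint[of s t L] less[OF x] s t by (simp add: slot_def)
      qed
      then have "s = t" using s(1) True by simp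
      then show ?thesis
        using less[OF x] s t True by (simp add: next_mode_slot) (simp add: slot_def)
    qed
    then have e: "{x \<in> U. next_mode L N x < next_mode L N b} = {}" by blast
    ultimately show ?thesis
      unfolding translation_sign_def t1[symmetric] div img e by simp
  next
    case False
    define K where "K = N - 1"
    have tl: "t < K" using False t by (simp add: K_def)
    have "before L K (insert b U) = insert b (before L K U)" "b \<notin> before L K U"
    proof -
      have "b < K * L" using slices_disjoint[OF tl, of L] t by (simp add: slot_def)
      then show "before L K (insert b U) = insert b (before L K U)" "b \<notin> before L K U"
        using bU by (auto simp: before_def)
    qed
    moreover have "finite (before L K U)" using fin by (simp add: before_def)
    moreover have "at_slice L K (insert b U) = at_slice L K U"
      using tl t by (auto simp: at_slice_def slot_eq_iff)
    \<comment> \<open>Last-slice modes land on slice 0, below the image of \<open>b\<close>, which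
      lies on slice \<open>t + 1\<close>; the other modes of \<open>U\<close> keep their order and
      stay above it.\<close>
    moreover have "{x \<in> U. next_mode L N x < next_mode L N b} = slot L K ` at_slice L K U"
    proof -
      have "next_mode L N x < next_mode L N b \<longleftrightarrow> x \<in> slice L K" if x: "x \<in> U" for x
      proof -
        obtain s j where s: "s < N" "j < L" "x = slot L s j" using mode_cases U x by blast
        show ?thesis
        proof (cases "Suc s = N")
          case True
          then have "next_mode L N x < next_mode L N b"
            using s t False by (simp add: next_mode_slot) (simp add: slot_def)
          moreover have "s = K" using True by (simp add: K_def)
          ultimately show ?thesis using s by (simp add: slot_def)
        next
          case F: False
          then have "\<not> next_mode L N x < next_mode L N b"
            using s t False less[OF x] by (simp add: next_mode_slot) (simp add: slot_def)
          moreover have "s < K" using F s by (simp add: K_def)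
          then have "x \<notin> slice L K"
            using slices_disjoint[of s "K" L] s by (simp add: slot_def)
          ultimately show ?thesis by simp
        qed
      qed
      then show ?thesis unfolding slot_at_slice by blast
    qed
    then have "card {x \<in> U. next_mode L N x < next_mode L N b} = card (at_slice L K U)"
      by (simp add: card_image[OF inj_slot])
    ultimately show ?thesis
      using tl unfolding translation_sign_def div img card_image[OF inj] K_def[symmetric]
      by (simp add: power_add)
  qed
qed

text \<open>Induction by adding a new smallest mode: the state of \<open>insert b U\<close> is then
  the creator of \<open>b\<close> applied to that of \<open>U\<close> without a sign.
  \<open>translation_fcre\<close> moves the translation past this creator, and
  \<open>translation_sign_insert\<close> records the sign that the shifted creator picks up.\<close>

lemma translation_apply:
  assumes "\<epsilon> > 0" "S \<subseteq> {..<L * N}" "U \<subseteq> {..<L * N}"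
  shows "translation L N \<epsilon> S U = (if S = next_mode L N ` U then translation_sign L N U else 0)"
proof -
  let ?M = "L * N" and ?X = "translation L N \<epsilon>"
  have "finite U" using assms(3) finite_subset by blast
  then show ?thesis
    using assms
  proof (induction U arbitrary: S rule: finite_linorder_min_induct)
    case empty
    then show ?case
      by (simp only: translation_vacuum)
        (simp add: fid_def translation_sign_def at_slice_def)
  next
    case (insert b U)
    have b: "b < ?M" and U: "U \<subseteq> {..<?M}" using insert.prems by auto
    let ?b = "next_mode L N b"
    obtain t i where t: "t < N" "i < L" "b = slot L t i" using mode_cases[OF b] .
    have bdiv: "b div L = N - 1 \<longleftrightarrow> Suc t = N" using t by (auto simp: slot_def)
    have bU: "b \<notin> U" using insert.hyps by blast
    have nb: "?b \<notin> next_mode L N ` U"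
      using bU U b inj_on_next_mode[of L N] by (auto dest: inj_onD)
    have "?X S (insert b U) = fmul ?M ?X (fcre b) S U"
    proof -
      have *: "fcre b T U = (if T = insert b U then 1 else 0)" for T
      proof -
        have e1: "{j \<in> insert b U. j < b} = {}" using insert.hyps by auto
        have e2: "b \<in> T \<and> U = T - {b} \<longleftrightarrow> T = insert b U" using bU by blast
        show ?thesis
          unfolding fcre_apply e2 by (simp only: e1 card.empty power_0 cong: if_cong)
      qed
      have "fmul ?M ?X (fcre b) S U = (\<Sum>T\<in>Pow {..<?M}. if T = insert b U then ?X S T else 0)"
        unfolding fmul_def * by (intro sum.cong) auto
      then show ?thesis using insert.prems by simp
    qed
    also have "\<dots> = (if Suc t = N then -1 else 1) * fmul ?M (fcre ?b) ?X S U"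
      unfolding t(3) using insert.prems U t by (intro translation_fcre) auto
    also have "fmul ?M (fcre ?b) ?X S U =
        (if ?b \<in> S then (-1) ^ card {j\<in>S. j < ?b} * ?X (S - {?b}) U else 0)"
      by (rule fmul_fcre[OF insert.prems(2)])
    also have "\<dots> = (if S = insert ?b (next_mode L N ` U)
        then (-1) ^ card {j\<in>S. j < ?b} * translation_sign L N U else 0)"
    proof -
      have e1: "?X (S - {?b}) U = (if S - {?b} = next_mode L N ` U then translation_sign L N U else 0)"
        using insert.prems U by (intro insert.IH) auto
      have e2: "?b \<in> S \<and> S - {?b} = next_mode L N ` U \<longleftrightarrow> S = insert ?b (next_mode L N ` U)"
        using nb by blast
      have "(if ?b \<in> S then (-1) ^ card {j\<in>S. j < ?b} * ?X (S - {?b}) U else 0) =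
          (if ?b \<in> S \<and> S - {?b} = next_mode L N ` U
           then (-1) ^ card {j\<in>S. j < ?b} * translation_sign L N U else 0)"
        unfolding e1 by simp
      then show ?thesis unfolding e2 .
    qed
    also have "(if Suc t = N then -1 else 1) * \<dots> = (if S = next_mode L N ` insert b U
        then translation_sign L N (insert b U) else 0)"
    proof -
      have sgn: "translation_sign L N (insert b U) = (if Suc t = N then -1 else 1) *
          (-1) ^ card {j \<in> insert ?b (next_mode L N ` U). j < ?b} * translation_sign L N U"
        using translation_sign_insert[OF b U] insert.hyps unfolding bdiv by blast
      show ?thesis
        by (cases "S = insert ?b (next_mode L N ` U)")
          (simp_all only: image_insert sgn if_True if_False mult.assoc mult_zero_right simp_thms)
    qed
    finally show ?case .
  qed
qed

section \<open>The trace identity\<close>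

lemma parity_big_apply:
  assumes "S \<subseteq> {..<L * N}" "U \<subseteq> {..<L * N}"
  shows "parity_big L N S U = (if S = U then (-1) ^ card S else 0)"
proof -
  have "fscale (\<i> * pi) (fsum ({..<N} \<times> {..<L}) (\<lambda>(t, i). fmul (L * N) (fcre (slot L t i)) (fann (slot L t i)))) S U =
      (if S = U then \<i> * complex_of_real pi * of_nat (card S) else 0)" if S: "S \<subseteq> {..<L * N}" for S U
  proof -
    have "(\<Sum>(t, i)\<in>{..<N} \<times> {..<L}. if slot L t i \<in> S then 1 else 0) =
        (\<Sum>m<L * N. if m \<in> S then 1 else (0::complex))"
      by (rule sum.reindex_bij_witness[of _ "\<lambda>m. (m div L, m mod L)" "\<lambda>(t, i). slot L t i"])
        (auto simp: slot_less less_mult_imp_div_less mult.commute elim: mode_cases, auto simp: slot_def)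
    also have "\<dots> = of_nat (card S)"
      using S by (simp add: sum.If_cases Int_absorb1)
    finally show ?thesis
      using S by (cases "S = U") (simp_all add: fscale_def fsum_def number_op_apply case_prod_unfold)
  qed
  then show ?thesis
    unfolding parity_big_def using assms by (subst fexp_diag) (auto simp: exp_i_pi_times_nat)
qed

lemma card_before:
  assumes "finite S"
  shows "card (before L t S) = (\<Sum>s<t. card (at_slice L s S))"
proof (induction t)
  case (Suc t)
  have "before L (Suc t) S = before L t S \<union> (S \<inter> slice L t)"
    by (auto simp: before_def)
  moreover have "before L t S \<inter> (S \<inter> slice L t) = {}"
    by (auto simp: before_def)
  moreover have "finite (before L t S)" "finite (S \<inter> slice L t)"
    using assms by (simp_all add: before_def)
  moreover have "card (S \<inter> slice L t) = card (at_slice L t S)"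
    by (metis slot_at_slice card_image inj_slot)
  ultimately show ?case
    using Suc by (simp add: card_Un_disjoint)
qed (simp add: before_def)

lemma before_all: "S \<subseteq> {..<L * N} \<Longrightarrow> before L N S = S"
  by (auto simp: before_def mult.commute)

text \<open>Time increases from right to left, as in a time-ordered product.\<close>

definition rising :: "nat \<Rightarrow> nat \<Rightarrow> (nat \<Rightarrow> fop) \<Rightarrow> nat \<Rightarrow> fop" where
  "rising L N Y m = mprod (L * N) (map (\<lambda>t. fres (L * N) (emb L N t (Y t))) (rev [0..<m]))"

lemma rising_0: "rising L N Y 0 = fone (L * N)"
  by (simp add: rising_def)

lemma rising_Suc:
  "rising L N Y (Suc m) = fmul (L * N) (fres (L * N) (emb L N m (Y m))) (rising L N Y m)"
  by (simp add: rising_def)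

text \<open>The leftmost factor changes only slice \<open>m\<close>, which is later than all
  remaining slices. Hence the counts before slices \<open>t < m\<close> are the same for
  \<open>S\<close> and for the unique intermediate state, and every sign can be expressed through
  the row \<open>S\<close>.\<close>

lemma rising_apply:
  assumes "m \<le> N" "S \<subseteq> {..<L * N}" "U \<subseteq> {..<L * N}"
  shows "rising L N Y m S U = (if S - {..<m * L} = U - {..<m * L} then
      (-1) ^ (\<Sum>t<m. card (before L t S) * (card (at_slice L t S) + card (at_slice L t U))) *
      (\<Prod>t<m. Y t (at_slice L t S) (at_slice L t U)) else 0)"
  using assms
proof (induction m arbitrary: S)
  case 0
  then show ?case by (simp add: rising_0 fone_def fid_def)
next
  case (Suc m)
  have m: "m < N" "m \<le> N" using Suc.prems by auto
  note S = Suc.prems(2) and U = Suc.prems(3)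
  let ?D = "rising L N Y m"
  define V where "V = put_slice L m S (at_slice L m U)"
  have V: "V \<subseteq> {..<L * N}" "V - slice L m = S - slice L m" "at_slice L m V = at_slice L m U"
    using S m by (simp_all add: V_def put_slice_subset put_slice_diff at_put_slice)
  have Vm: "V \<inter> slice L m = U \<inter> slice L m"
    using V(3) by (simp add: at_slice_eq_iff)
  have split: "{..<Suc m * L} = {..<m * L} \<union> slice L m" "{..<m * L} \<inter> slice L m = {}"
    by auto
  have cond: "V - {..<m * L} = U - {..<m * L} \<longleftrightarrow> S - {..<Suc m * L} = U - {..<Suc m * L}"
    using V(2) Vm split by blast
  have at: "at_slice L t V = at_slice L t S" "before L t V = before L t S" if "t < m" for t
    using at_slice_cong_outside[OF V(2), of t] before_cong_outside[OF V(2), of t] that by auto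
  have uniq: "T = V" if "S - slice L m = T - slice L m" "T - {..<m * L} = U - {..<m * L}" for T
  proof -
    have "T \<inter> slice L m = U \<inter> slice L m" using that(2) split(2) by blast
    then have "at_slice L m T = at_slice L m U" by (simp add: at_slice_eq_iff)
    then show ?thesis using put_slice_self[OF that(1)] by (simp add: V_def)
  qed
  have "rising L N Y (Suc m) S U = (\<Sum>T\<in>Pow {..<L * N}. if T = V then emb L N m (Y m) S T * ?D T U else 0)"
    unfolding rising_Suc fmul_def
  proof (rule sum.cong[OF refl])
    fix T assume "T \<in> Pow {..<L * N}"
    then have T: "T \<subseteq> {..<L * N}" by simp
    have "emb L N m (Y m) S T * ?D T U = 0" if "T \<noteq> V"
      using uniq[of T] that emb_apply[OF m(1) S T, of "Y m"] Suc.IH[OF m(2) T U] by auto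
    then show "fres (L * N) (emb L N m (Y m)) S T * ?D T U =
        (if T = V then emb L N m (Y m) S T * ?D T U else 0)"
      using S T by simp
  qed
  also have "\<dots> = emb L N m (Y m) S V * ?D V U"
    using V(1) by simp
  finally show ?case
    using emb_apply[OF m(1) S V(1), of "Y m"] Suc.IH[OF m(2) V(1) U] V(2,3)
    by (simp only: cond) (simp add: at power_add)
qed

lemma at_slice_next_mode:
  assumes "S \<subseteq> {..<L * N}" "t < N"
  shows "at_slice L t (next_mode L N ` S) =
    (if t = 0 then at_slice L (N - 1) S else at_slice L (t - 1) S)"
proof -
  define s where "s = (if t = 0 then N - 1 else t - 1)"
  have s: "s < N" "next_mode L N (slot L s i) = slot L t i" if "i < L" for i
    using assms(2) that by (auto simp: s_def next_mode_slot)
  have "slot L t i \<in> next_mode L N ` S \<longleftrightarrow> slot L s i \<in> S" if i: "i < L" for i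
  proof
    assume "slot L t i \<in> next_mode L N ` S"
    then obtain x where x: "x \<in> S" "next_mode L N x = next_mode L N (slot L s i)"
      using s(2)[OF i] by auto
    then have "x = slot L s i"
      using inj_onD[OF inj_on_next_mode x(2)] assms(1) slot_less[OF s(1) i] i by auto
    with x show "slot L s i \<in> S" by simp
  next
    assume "slot L s i \<in> S"
    then show "slot L t i \<in> next_mode L N ` S" using s(2)[OF i] by (metis imageI)
  qed
  then have "at_slice L t (next_mode L N ` S) = at_slice L s S"
    by (auto simp: at_slice_def)
  then show ?thesis by (simp add: s_def)
qed

text \<open>With \<open>n t\<close> particles on slice \<open>t\<close> and \<open>K\<close> the
  last slice, this is modulo 2 the exponent that remains in the trace: the sum collects the signs of
  the slice operators, the last summand what is left of parity and translation sign. The truncated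
  \<open>t - 1\<close> at \<open>t = 0\<close> is harmless, since its factor is an empty
  sum.\<close>

lemma cyclic_sign_even:
  fixes n :: "nat \<Rightarrow> nat"
  shows "even ((\<Sum>t<Suc K. (\<Sum>s<t. n s) * (n t + n (t - 1))) + (\<Sum>s<K. n s) * (n K + 1))"
proof (induction K)
  case (Suc K)
  define m A where "m = (\<Sum>s<K. n s)" and "A = (\<Sum>t<Suc K. (\<Sum>s<t. n s) * (n t + n (t - 1)))"
  define x y z where "x = (m + n K) * (n (Suc K) + n K)"
    and "y = (m + n K) * (n (Suc K) + 1)" and "z = m * (n K + 1)"
  have "even (A + z)" using Suc by (simp only: A_def m_def z_def)
  \<comment> \<open>Modulo 2, \<open>x + y\<close> is \<open>(m + n K) * (n K + 1)\<close>, which is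
    \<open>z\<close> because \<open>n K * (n K + 1)\<close> is even.\<close>
  moreover have "even (x + y + z)"
    unfolding x_def y_def z_def
    by (cases "even m"; cases "even (n K)"; cases "even (n (Suc K))") simp_all
  ultimately have "even (A + x + y)" by presburger
  then show ?case
    by (simp only: A_def x_def y_def m_def sum.lessThan_Suc[of _ "Suc K"] sum.lessThan_Suc[of n]
        diff_Suc_1)
qed simp

text \<open>A subset \<open>T\<close> of \<open>{..<L * m}\<close> encodes a path of \<open>m\<close> states of the small Fock space, one per
  slice, started at \<open>U\<close>.\<close>

definition prev_state :: "nat \<Rightarrow> nat set \<Rightarrow> nat set \<Rightarrow> nat \<Rightarrow> nat set" where
  "prev_state L U T t = (if t = 0 then U else at_slice L (t - 1) T)"

text \<open>A matrix product expanded over its intermediate states. Packing these into one subset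
  \<open>T\<close> matches them with the basis states of the big trace. The end state also sits in
  \<open>T\<close> and is fixed by a condition, which becomes the closing condition of the path when
  the small trace is taken.\<close>

lemma mprod_apply_paths:
  assumes "S \<subseteq> {..<L}" "U \<subseteq> {..<L}"
  shows "mprod L (map Y (rev [0..<m])) S U =
    (\<Sum>T\<in>Pow {..<L * m}. if prev_state L U T m = S
      then \<Prod>t<m. Y t (prev_state L U T (Suc t)) (prev_state L U T t) else 0)"
  using assms(1)
proof (induction m arbitrary: S)
  case 0
  then show ?case using assms(2) by (simp add: prev_state_def fone_def fid_def)
next
  case (Suc m)
  let ?p = "prev_state L U"
  let ?f = "\<lambda>T. \<Prod>t<m. Y t (?p T (Suc t)) (?p T t)"
  have p: "?p T t \<subseteq> {..<L}" for T t
    using assms(2) by (simp add: prev_state_def)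
  have "mprod L (map Y (rev [0..<Suc m])) S U =
      (\<Sum>R\<in>Pow {..<L}. Y m S R * (\<Sum>T\<in>Pow {..<L * m}. if ?p T m = R then ?f T else 0))"
    using Suc.IH by (simp add: fmul_def)
  also have "\<dots> = (\<Sum>R\<in>Pow {..<L}. \<Sum>T\<in>Pow {..<L * m}. if R = ?p T m then Y m S R * ?f T else 0)"
    unfolding sum_distrib_left by (intro sum.cong refl) auto
  also have "\<dots> = (\<Sum>T\<in>Pow {..<L * m}. \<Sum>R\<in>Pow {..<L}. if R = ?p T m then Y m S R * ?f T else 0)"
    by (rule sum.swap)
  also have "\<dots> = (\<Sum>T\<in>Pow {..<L * m}. Y m S (?p T m) * ?f T)"
    using p by (intro sum.cong refl) simp
  also have "\<dots> = (\<Sum>T\<in>{T \<in> Pow {..<L * Suc m}. at_slice L m T = S}.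
      \<Prod>t<Suc m. Y t (?p T (Suc t)) (?p T t))"
  \<comment> \<open>Prolonging a path appends the end state \<open>S\<close> as slice
    \<open>m\<close>; forgetting that slice undoes it.\<close>
  proof (rule sum.reindex_bij_witness[of _ "\<lambda>T. T - slice L m" "\<lambda>T. put_slice L m T S"])
    fix T assume T: "T \<in> Pow {..<L * m}"
    then have d: "T - slice L m = T" by (auto simp: mult.commute)
    show "put_slice L m T S - slice L m = T"
      using put_slice_diff[OF Suc.prems] d by simp
    have "T \<subseteq> {..<L * Suc m}" using T by auto
    then show "put_slice L m T S \<in> {T \<in> Pow {..<L * Suc m}. at_slice L m T = S}"
      using put_slice_subset[OF _ Suc.prems, of T "Suc m" m] at_put_slice[OF Suc.prems] by simp
    have "?p (put_slice L m T S) t = ?p T t" if "t \<le> m" for t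
      using that at_slice_cong_outside[OF put_slice_diff[OF Suc.prems, of m T], of "t - 1"]
      by (auto simp: prev_state_def)
    moreover have "?p (put_slice L m T S) (Suc m) = S"
      using at_put_slice[OF Suc.prems] by (simp add: prev_state_def)
    ultimately show "(\<Prod>t<Suc m. Y t (?p (put_slice L m T S) (Suc t)) (?p (put_slice L m T S) t)) =
        Y m S (?p T m) * ?f T"
      by simp
  next
    fix T assume T: "T \<in> {T \<in> Pow {..<L * Suc m}. at_slice L m T = S}"
    then show "put_slice L m (T - slice L m) S = T"
      using put_slice_self[where S = "T - slice L m" and U = T and L = L and t = m] by auto
    show "T - slice L m \<in> Pow {..<L * m}"
      using T by (fastforce simp: mult.commute)
  qed
  also have "\<dots> = (\<Sum>T\<in>Pow {..<L * Suc m}. if ?p T (Suc m) = S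
      then \<Prod>t<Suc m. Y t (?p T (Suc t)) (?p T t) else 0)"
    by (subst sum.inter_filter) (simp_all add: prev_state_def)
  finally show ?case .
qed

text \<open>Three signs meet for each path \<open>T\<close>: \<open>card T\<close> from parity,
  \<open>translation_sign\<close> from the wrap, and the Jordan-Wigner exponents of
  \<open>rising_apply\<close>. Their total is even by \<open>cyclic_sign_even\<close>.\<close>

lemma trace_translation:
  assumes "\<epsilon> > 0" "N \<ge> 1"
  shows "ftr (L * N) (fmul (L * N) (parity_big L N) (fmul (L * N) (translation L N \<epsilon>) (rising L N Y N)))
    = ftr L (mprod L (map Y (rev [0..<N])))"
proof -
  let ?M = "L * N" and ?X = "translation L N \<epsilon>" and ?D = "rising L N Y N"
  let ?shift = "\<lambda>S. next_mode L N ` S"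
  obtain K where K: "N = Suc K" using assms(2) by (cases N) auto
  have sub: "?shift S \<subseteq> {..<?M}" if "S \<subseteq> {..<?M}" for S
    using that next_mode_less[of _ L N] by auto
  have cardsh: "card (?shift S) = card S" if "S \<subseteq> {..<?M}" for S
    using that by (intro card_image inj_on_subset[OF inj_on_next_mode])
  have "ftr ?M (fmul ?M (parity_big L N) (fmul ?M ?X ?D)) =
      (\<Sum>S'\<in>Pow {..<?M}. \<Sum>T\<in>Pow {..<?M}. if S' = ?shift T
        then (-1) ^ card S' * (translation_sign L N T * ?D T S') else 0)"
    unfolding ftr_def
  proof (rule sum.cong[OF refl])
    fix S' assume "S' \<in> Pow {..<?M}"
    then have S': "S' \<subseteq> {..<?M}" by simp
    have "fmul ?M (parity_big L N) (fmul ?M ?X ?D) S' S' =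
        (\<Sum>R\<in>Pow {..<?M}. if R = S' then (-1) ^ card S' * fmul ?M ?X ?D R S' else 0)"
      unfolding fmul_def[of _ "parity_big L N"] using S'
      by (intro sum.cong refl) (simp add: parity_big_apply)
    also have "\<dots> = (-1) ^ card S' * fmul ?M ?X ?D S' S'"
      using S' by simp
    also have "\<dots> = (\<Sum>T\<in>Pow {..<?M}. if S' = ?shift T
        then (-1) ^ card S' * (translation_sign L N T * ?D T S') else 0)"
      unfolding fmul_def sum_distrib_left using S' assms(1)
      by (intro sum.cong refl) (simp add: translation_apply)
    finally show "fmul ?M (parity_big L N) (fmul ?M ?X ?D) S' S' = (\<Sum>T\<in>Pow {..<?M}. if S' = ?shift T
        then (-1) ^ card S' * (translation_sign L N T * ?D T S') else 0)" .
  qed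
  also have "\<dots> = (\<Sum>T\<in>Pow {..<?M}. \<Sum>S'\<in>Pow {..<?M}. if S' = ?shift T
        then (-1) ^ card S' * (translation_sign L N T * ?D T S') else 0)"
    by (rule sum.swap)
  also have "\<dots> = (\<Sum>T\<in>Pow {..<?M}. (-1) ^ card T * (translation_sign L N T * ?D T (?shift T)))"
    using sub cardsh by (intro sum.cong refl) simp
  also have "\<dots> = (\<Sum>T\<in>Pow {..<?M}. \<Prod>t<N. Y t (at_slice L t T) (prev_state L (at_slice L K T) T t))"
  proof (rule sum.cong[OF refl])
    fix T assume "T \<in> Pow {..<?M}"
    then have T: "T \<subseteq> {..<?M}" by simp
    then have fin: "finite T" using finite_subset by blast
    define n where "n t = card (at_slice L t T)" for t
    have at: "at_slice L t (?shift T) = prev_state L (at_slice L K T) T t" if "t < N" for t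
      using at_slice_next_mode[OF T that] by (simp add: prev_state_def K)
    let ?e = "\<Sum>t<N. card (before L t T) * (card (at_slice L t T) + card (at_slice L t (?shift T)))"
    have D: "?D T (?shift T) = (-1) ^ ?e * (\<Prod>t<N. Y t (at_slice L t T) (prev_state L (at_slice L K T) T t))"
    proof -
      have "T - {..<N * L} = ?shift T - {..<N * L}"
        using T sub[OF T] by (auto simp: mult.commute)
      moreover have "(\<Prod>t<N. Y t (at_slice L t T) (at_slice L t (?shift T))) =
          (\<Prod>t<N. Y t (at_slice L t T) (prev_state L (at_slice L K T) T t))"
        by (intro prod.cong) (simp_all add: at)
      ultimately show ?thesis
        using rising_apply[OF order_refl T sub[OF T], of Y] by simp
    qed
    have b: "card (before L t T) = (\<Sum>s<t. n s)" for t
      using card_before[OF fin] by (simp add: n_def)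
    have e: "?e = (\<Sum>t<Suc K. (\<Sum>s<t. n s) * (n t + n (t - 1)))"
      unfolding K[symmetric] b
      by (intro sum.cong refl) (auto simp: at prev_state_def n_def)
    have c: "card T = (\<Sum>s<Suc K. n s)"
      using b[of N] unfolding before_all[OF T] K[symmetric] .
    have s: "translation_sign L N T = (-1) ^ (n K * (1 + (\<Sum>s<K. n s)))"
      unfolding translation_sign_def b n_def[symmetric] by (simp add: K)
    have "even (card T + (n K * (1 + (\<Sum>s<K. n s)) + ?e))"
    proof -
      define A m where "A = (\<Sum>t<Suc K. (\<Sum>s<t. n s) * (n t + n (t - 1)))" and "m = (\<Sum>s<K. n s)"
      have "even (A + m * (n K + 1))" using cyclic_sign_even[of n K] by (simp only: A_def m_def)
      moreover have "m + n K + (n K * (1 + m) + A) = (A + m * (n K + 1)) + 2 * n K"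
        by (simp add: algebra_simps)
      ultimately have "even (m + n K + (n K * (1 + m) + A))" by (metis dvd_add dvd_triv_left)
      then show ?thesis by (simp only: e c A_def m_def sum.lessThan_Suc[of n])
    qed
    then have "(-1::complex) ^ (card T + (n K * (1 + (\<Sum>s<K. n s)) + ?e)) = 1"
      by (rule neg_one_even_power)
    then have sgn: "(-1::complex) ^ card T * (-1) ^ (n K * (1 + (\<Sum>s<K. n s))) * (-1) ^ ?e = 1"
      by (simp only: power_add mult.assoc)
    show "(-1) ^ card T * (translation_sign L N T * ?D T (?shift T)) =
        (\<Prod>t<N. Y t (at_slice L t T) (prev_state L (at_slice L K T) T t))"
      unfolding D s mult.assoc[symmetric] sgn by (rule mult_1_left)
  qed
  \<comment> \<open>The state on the last slice is named \<open>S\<close>: it is the end of the path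
    and also the state entering at \<open>t = 0\<close>, so the outer sum over \<open>S\<close> is
    the small trace.\<close>
  also have "\<dots> = (\<Sum>T\<in>Pow {..<?M}. \<Sum>S\<in>Pow {..<L}. if S = at_slice L K T
      then \<Prod>t<N. Y t (at_slice L t T) (prev_state L S T t) else 0)"
    by (intro sum.cong refl) simp
  also have "\<dots> = (\<Sum>S\<in>Pow {..<L}. \<Sum>T\<in>Pow {..<?M}. if S = at_slice L K T
      then \<Prod>t<N. Y t (at_slice L t T) (prev_state L S T t) else 0)"
    by (rule sum.swap)
  also have "\<dots> = ftr L (mprod L (map Y (rev [0..<N])))"
    unfolding ftr_def
  proof (rule sum.cong[OF refl])
    fix S assume "S \<in> Pow {..<L}"
    then have S: "S \<subseteq> {..<L}" by simp
    show "(\<Sum>T\<in>Pow {..<?M}. if S = at_slice L K T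
        then \<Prod>t<N. Y t (at_slice L t T) (prev_state L S T t) else 0) =
        mprod L (map Y (rev [0..<N])) S S"
      unfolding mprod_apply_paths[OF S S]
      by (intro sum.cong refl) (auto simp: prev_state_def K)
  qed
  finally show ?thesis .
qed

section \<open>Stable sorting and its sign\<close>

text \<open>Original positions are the numbers themselves, so breaking ties by size expresses
  stability and makes the sorted order strict.\<close>

definition stable_less :: "(nat \<Rightarrow> real) \<Rightarrow> nat \<Rightarrow> nat \<Rightarrow> bool" where
  "stable_less f i j \<longleftrightarrow> f i < f j \<or> f i = f j \<and> i < j"

lemma sorted_wrt_insort_key:
  assumes "sorted_wrt (stable_less f) ys" "\<And>y. y \<in> set ys \<Longrightarrow> x < y"
  shows "sorted_wrt (stable_less f) (insort_key f x ys)"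
  using assms
proof (induction ys)
  case (Cons y ys)
  show ?case
  proof (cases "f x \<le> f y")
    case True
    have "stable_less f x z" if "z \<in> set (y # ys)" for z
    proof -
      have "f y \<le> f z" using that Cons.prems(1) by (auto simp: stable_less_def)
      with True Cons.prems(2)[OF that] show ?thesis by (auto simp: stable_less_def)
    qed
    with True Cons.prems show ?thesis by simp
  next
    case False
    then have "stable_less f y x" by (simp add: stable_less_def)
    with False Cons show ?thesis by (simp add: set_insort_key)
  qed
qed simp

lemma sorted_wrt_sort_key:
  "sorted_wrt (<) xs \<Longrightarrow> sorted_wrt (stable_less f) (sort_key f xs)"
  by (induction xs) (auto intro!: sorted_wrt_insort_key)

lemma length_filter_insort_key:
  "length (filter P (insort_key f x ys)) = length (filter P (x # ys))"
  by (induction ys) auto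

text \<open>The recursion follows insertion sort: the first summand counts the flagged entries that
  \<open>x\<close> has to pass, a number that does not depend on whether the tail has been sorted
  already.\<close>

fun inversions :: "(nat \<Rightarrow> real) \<Rightarrow> (nat \<Rightarrow> bool) \<Rightarrow> nat list \<Rightarrow> nat" where
  "inversions f c [] = 0"
| "inversions f c (x # xs) = length (filter (\<lambda>y. f y < f x \<and> c x \<and> c y) xs) + inversions f c xs"

lemma inversions_eq_card:
  assumes "sorted_wrt (<) xs"
  shows "inversions f c xs =
    card {(i, j). i \<in> set xs \<and> j \<in> set xs \<and> i < j \<and> f j < f i \<and> c i \<and> c j}"
  using assms
proof (induction xs)
  case (Cons x xs)
  let ?B = "\<lambda>xs. {(i, j). i \<in> set xs \<and> j \<in> set xs \<and> i < j \<and> f j < f i \<and> c i \<and> c j}"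
  let ?C = "{y \<in> set xs. f y < f x \<and> c x \<and> c y}"
  have dist: "distinct xs" using Cons.prems strict_sorted_iff by auto
  have less: "x < y" if "y \<in> set xs" for y using that Cons.prems by simp
  have "?B (x # xs) = Pair x ` ?C \<union> ?B xs"
    using less by (fastforce dest: less_asym)
  moreover have "Pair x ` ?C \<inter> ?B xs = {}"
    using less by auto
  moreover have "finite (?B xs)"
    by (rule finite_subset[of _ "set xs \<times> set xs"]) auto
  moreover have "card (Pair x ` ?C) = length (filter (\<lambda>y. f y < f x \<and> c x \<and> c y) xs)"
    using dist by (subst card_image) (auto simp: inj_on_def distinct_length_filter Int_def conj_commute)
  ultimately show ?case
    using Cons by (simp add: card_Un_disjoint)
qed simp

text \<open>\<open>tord_gamma\<close> counts positions in the sorted list, \<open>inversions\<close>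
  counts entries of the original one. Sending \<open>(p, q)\<close> to the entries at
  \<open>q\<close> and \<open>p\<close> is a bijection; by stability a reversed pair has distinct
  labels.\<close>

lemma tord_gamma_eq_inversions:
  "tord_gamma lab k cs = inversions (\<lambda>l. - lab l) ((!) cs) [0..<k]"
proof -
  define f where "f = (\<lambda>l. - lab l)"
  define \<sigma> where "\<sigma> = tord_perm lab k"
  define A where "A = {(p, q). p < q \<and> q < k \<and> \<sigma> ! q < \<sigma> ! p \<and> cs ! (\<sigma> ! p) \<and> cs ! (\<sigma> ! q)}"
  define B where "B = {(i, j). i \<in> set [0..<k] \<and> j \<in> set [0..<k] \<and> i < j \<and> f j < f i \<and> cs ! i \<and> cs ! j}"
  have \<sigma>: "length \<sigma> = k" "set \<sigma> = {0..<k}" "distinct \<sigma>" "sorted_wrt (stable_less f) \<sigma>"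
    unfolding \<sigma>_def tord_perm_def f_def by (simp_all add: sorted_wrt_sort_key)
  have nth_in: "\<sigma> ! p < k" if "p < k" for p
    using \<sigma>(1,2) nth_mem[of p \<sigma>] that by simp
  have less: "stable_less f (\<sigma> ! p) (\<sigma> ! q)" if "p < q" "q < k" for p q
    using sorted_wrt_nth_less[OF \<sigma>(4)] that \<sigma>(1) by simp
  let ?h = "\<lambda>(p, q). (\<sigma> ! q, \<sigma> ! p)"
  have "inj_on ?h A"
    using \<sigma>(1,3) by (auto simp: inj_on_def A_def nth_eq_iff_index_eq)
  moreover have "?h ` A = B"
  proof (intro equalityI subsetI)
    fix x assume "x \<in> ?h ` A"
    then obtain p q where x: "x = (\<sigma> ! q, \<sigma> ! p)" "p < q" "q < k" "\<sigma> ! q < \<sigma> ! p"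
      "cs ! (\<sigma> ! p)" "cs ! (\<sigma> ! q)" by (auto simp: A_def)
    then show "x \<in> B"
      using less[OF x(2,3)] nth_in[of p] nth_in[of q] by (auto simp: B_def stable_less_def)
  next
    fix x assume "x \<in> B"
    then obtain i j where x: "x = (i, j)" "i < k" "j < k" "i < j" "f j < f i" "cs ! i" "cs ! j"
      by (auto simp: B_def)
    obtain p q where pq: "p < k" "\<sigma> ! p = j" "q < k" "\<sigma> ! q = i"
      using x(2,3) \<sigma>(1,2) by (metis atLeastLessThan_iff in_set_conv_nth le0)
    have "p < q"
    proof (rule ccontr)
      assume "\<not> p < q"
      moreover have "p \<noteq> q" using pq x(4) by auto
      ultimately show False
        using less[of q p] pq x(4,5) by (auto simp: stable_less_def)
    qed
    then have "(p, q) \<in> A" using pq x by (auto simp: A_def)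
    then show "x \<in> ?h ` A" using pq x(1) by force
  qed
  ultimately have "card A = card B" using card_image by fastforce
  moreover have "tord_gamma lab k cs = card A"
    by (simp add: tord_gamma_def A_def \<sigma>_def)
  moreover have "inversions f ((!) cs) [0..<k] = card B"
    unfolding B_def by (rule inversions_eq_card) simp
  ultimately show ?thesis
    by (simp add: f_def)
qed

text \<open>\<open>F x\<close> moves right past entries of strictly smaller key and stops at the
  first other one. Only pairs with distinct keys are exchanged, so the exchange rule is assumed for
  these alone.\<close>

lemma mprod_insort_key:
  assumes "sorted_wrt (stable_less f) ys"
    and "\<And>i j. i \<in> set (x # ys) \<Longrightarrow> j \<in> set (x # ys) \<Longrightarrow> f i \<noteq> f j \<Longrightarrow>
      fmul M (F i) (F j) = fscale (if c i \<and> c j then -1 else 1) (fmul M (F j) (F i))"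
  shows "fmul M (F x) (mprod M (map F ys)) =
    fscale ((-1) ^ length (filter (\<lambda>y. f y < f x \<and> c x \<and> c y) ys))
      (mprod M (map F (insort_key f x ys)))"
  using assms
proof (induction ys)
  case Nil
  then show ?case by (simp add: fscale_def)
next
  case (Cons y ys)
  show ?case
  proof (cases "f x \<le> f y")
    case True
    have "\<not> f z < f x" if "z \<in> set (y # ys)" for z
    proof -
      have "f y \<le> f z" using that Cons.prems(1) by (auto simp: stable_less_def)
      with True show ?thesis by simp
    qed
    then have "filter (\<lambda>z. f z < f x \<and> c x \<and> c z) (y # ys) = []"
      by (auto simp: filter_empty_conv)
    with True show ?thesis by (simp add: fscale_def)
  next
    case False
    have IH: "fmul M (F x) (mprod M (map F ys)) =
        fscale ((-1) ^ length (filter (\<lambda>y. f y < f x \<and> c x \<and> c y) ys))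
          (mprod M (map F (insort_key f x ys)))"
    proof (rule Cons.IH)
      show "sorted_wrt (stable_less f) ys" using Cons.prems(1) by simp
      show "fmul M (F i) (F j) = fscale (if c i \<and> c j then -1 else 1) (fmul M (F j) (F i))"
        if "i \<in> set (x # ys)" "j \<in> set (x # ys)" "f i \<noteq> f j" for i j
        using that by (intro Cons.prems(2)) auto
    qed
    have "fmul M (F x) (mprod M (map F (y # ys))) = fmul M (fmul M (F x) (F y)) (mprod M (map F ys))"
      by (simp add: fmul_assoc)
    also have "fmul M (F x) (F y) = fscale (if c x \<and> c y then -1 else 1) (fmul M (F y) (F x))"
      using False by (intro Cons.prems(2)) auto
    also have "fmul M \<dots> (mprod M (map F ys)) = fscale (if c x \<and> c y then -1 else 1)
        (fscale ((-1) ^ length (filter (\<lambda>y. f y < f x \<and> c x \<and> c y) ys))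
          (fmul M (F y) (mprod M (map F (insort_key f x ys)))))"
      by (simp only: fmul_fscale_left fmul_assoc IH fmul_fscale_right)
    finally show ?thesis
      using False by (auto simp: fscale_def)
  qed
qed

lemma mprod_sort_key:
  assumes "sorted_wrt (<) xs"
    and "\<And>i j. i \<in> set xs \<Longrightarrow> j \<in> set xs \<Longrightarrow> f i \<noteq> f j \<Longrightarrow>
      fmul M (F i) (F j) = fscale (if c i \<and> c j then -1 else 1) (fmul M (F j) (F i))"
  shows "mprod M (map F xs) = fscale ((-1) ^ inversions f c xs) (mprod M (map F (sort_key f xs)))"
  using assms
proof (induction xs)
  case Nil
  then show ?case by (simp add: fscale_def)
next
  case (Cons x xs)
  have IH: "mprod M (map F xs) = fscale ((-1) ^ inversions f c xs) (mprod M (map F (sort_key f xs)))"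
  proof (rule Cons.IH)
    show "sorted_wrt (<) xs" using Cons.prems(1) by simp
    show "fmul M (F i) (F j) = fscale (if c i \<and> c j then -1 else 1) (fmul M (F j) (F i))"
      if "i \<in> set xs" "j \<in> set xs" "f i \<noteq> f j" for i j
      using that by (intro Cons.prems(2)) auto
  qed
  have len: "length (filter P (sort_key f xs)) = length (filter P xs)" for P
    by (induction xs) (simp_all add: length_filter_insort_key)
  have ins: "fmul M (F x) (mprod M (map F (sort_key f xs))) =
    fscale ((-1) ^ length (filter (\<lambda>y. f y < f x \<and> c x \<and> c y) (sort_key f xs)))
      (mprod M (map F (insort_key f x (sort_key f xs))))"
  proof (rule mprod_insort_key)
    show "sorted_wrt (stable_less f) (sort_key f xs)"
      using Cons.prems(1) by (simp add: sorted_wrt_sort_key)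
    show "fmul M (F i) (F j) = fscale (if c i \<and> c j then -1 else 1) (fmul M (F j) (F i))"
      if "i \<in> set (x # sort_key f xs)" "j \<in> set (x # sort_key f xs)" "f i \<noteq> f j" for i j
      using that by (intro Cons.prems(2)) auto
  qed
  show ?case
    unfolding list.map mprod_Cons IH fmul_fscale_right ins len
    by (simp add: fscale_def power_add mult_ac)
qed

section \<open>Even and odd parts\<close>

abbreviation parity_part :: "nat \<Rightarrow> bool \<Rightarrow> fop \<Rightarrow> fop" where
  "parity_part L c A \<equiv> if c then odd_part L A else even_part L A"

lemma fmul_parity_h_left:
  assumes "S \<subseteq> {..<L}"
  shows "fmul L (parity_h L) A S U = (-1) ^ card S * A S U"
proof -
  have "fmul L (parity_h L) A S U = (\<Sum>T\<in>Pow {..<L}. if T = S then (-1) ^ card S * A T U else 0)"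
    unfolding fmul_def using assms by (intro sum.cong refl) (simp add: parity_h_apply)
  then show ?thesis using assms by simp
qed

lemma fmul_parity_h_right:
  assumes "U \<subseteq> {..<L}"
  shows "fmul L A (parity_h L) S U = (-1) ^ card U * A S U"
proof -
  have "fmul L A (parity_h L) S U = (\<Sum>T\<in>Pow {..<L}. if T = U then (-1) ^ card U * A S T else 0)"
    unfolding fmul_def using assms by (intro sum.cong refl) (simp add: parity_h_apply)
  then show ?thesis using assms by simp
qed

text \<open>Conjugation by \<open>parity_h\<close> multiplies an entry by
  \<open>(-1) ^ (card S + card U)\<close>, so each part keeps the entries of its own parity.\<close>

lemma parity_part_apply:
  assumes "S \<subseteq> {..<L}" "U \<subseteq> {..<L}"
  shows "parity_part L c A S U = (if odd (card S + card U) = c then A S U else 0)"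
  using assms
  by (auto simp: odd_part_def even_part_def fscale_def fadd_def fmul_parity_h_left
      fmul_parity_h_right minus_one_power_iff)

lemma homogeneous_parity_part: "homogeneous L c (parity_part L c A)"
  unfolding homogeneous_def
proof (intro allI impI)
  fix S U assume SU: "S \<subseteq> {..<L}" "U \<subseteq> {..<L}" "parity_part L c A S U \<noteq> 0"
  show "odd (card S + card U) = c"
    using SU(3) unfolding parity_part_apply[OF SU(1,2)] by (rule contrapos_np) simp
qed

lemma homogeneous_fres: "homogeneous L c (fres L A) \<longleftrightarrow> homogeneous L c A"
  by (simp add: homogeneous_def)

lemma emb_sum_parity_parts:
  assumes "t < N"
  shows "fres (L * N) (emb L N t A) =
    fsum UNIV (\<lambda>c. fres (L * N) (emb L N t (fres L (parity_part L c A))))"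
  unfolding fres_fsum[symmetric]
proof (rule fres_eqI)
  fix S U assume SU: "S \<subseteq> {..<L * N}" "U \<subseteq> {..<L * N}"
  show "emb L N t A S U = fsum UNIV (\<lambda>c. emb L N t (fres L (parity_part L c A))) S U"
    unfolding fsum_def emb_apply[OF assms SU]
    by (simp only: fres_apply at_slice_subset parity_part_apply UNIV_bool) simp
qed

text \<open>\<open>B\<close> may have mixed parity: each of its two parts has a graded commutation
  rule, whose sign is 1 against an even operator.\<close>

lemma emb_even_commute:
  assumes "s \<noteq> t" "s < N" "t < N" "homogeneous L False A"
  shows "fmul (L * N) (fres (L * N) (emb L N s A)) (fres (L * N) (emb L N t B)) =
      fmul (L * N) (fres (L * N) (emb L N t B)) (fres (L * N) (emb L N s A))"
proof -
  have "fmul (L * N) (fres (L * N) (emb L N s A)) (fres (L * N) (emb L N t (fres L (parity_part L c B)))) =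
      fmul (L * N) (fres (L * N) (emb L N t (fres L (parity_part L c B)))) (fres (L * N) (emb L N s A))" for c
    using emb_graded_commute[OF assms, of c "fres L (parity_part L c B)"]
      homogeneous_parity_part[of L c B] unfolding homogeneous_fres by (simp add: fscale_def)
  then show ?thesis
    unfolding emb_sum_parity_parts[OF assms(3), of L B] fmul_fsum_left fmul_fsum_right by simp
qed

text \<open>Even factors do not change the parity of a matrix entry. With the two evolution
  exponentials as \<open>E\<close> and \<open>E'\<close>, taking parity parts therefore commutes
  with passing to the Heisenberg picture.\<close>

lemma parity_part_conjugate:
  assumes "homogeneous L False E" "homogeneous L False E'"
  shows "fres L (parity_part L c (fmul L E (fmul L A E'))) =
    fmul L (fres L E) (fmul L (fres L (parity_part L c A)) (fres L E'))"
  unfolding fres_fmul[symmetric]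
proof (rule fres_eqI)
  fix S U assume S: "S \<subseteq> {..<L}" and U: "U \<subseteq> {..<L}"
  have "fmul L E (fmul L (parity_part L c A) E') S U =
      (\<Sum>T\<in>Pow {..<L}. \<Sum>R\<in>Pow {..<L}. E S T * (parity_part L c A T R * E' R U))"
    by (simp add: fmul_def sum_distrib_left)
  also have "\<dots> = (\<Sum>T\<in>Pow {..<L}. \<Sum>R\<in>Pow {..<L}.
      if odd (card S + card U) = c then E S T * (A T R * E' R U) else 0)"
  proof (intro sum.cong refl)
    fix T R assume "T \<in> Pow {..<L}" "R \<in> Pow {..<L}"
    then have TR: "T \<subseteq> {..<L}" "R \<subseteq> {..<L}" by auto
    show "E S T * (parity_part L c A T R * E' R U) =
        (if odd (card S + card U) = c then E S T * (A T R * E' R U) else 0)"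
    proof (cases "E S T = 0 \<or> E' R U = 0")
      case False
      then have "even (card S + card T)" "even (card R + card U)"
        using assms S U TR by (auto simp: homogeneous_def)
      then have "odd (card T + card R) = odd (card S + card U)" by auto
      then show ?thesis unfolding parity_part_apply[OF TR] by simp
    qed auto
  qed
  also have "\<dots> = (if odd (card S + card U) = c then fmul L E (fmul L A E') S U else 0)"
    by (simp add: fmul_def sum_distrib_left)
  finally show "parity_part L c (fmul L E (fmul L A E')) S U =
      fmul L E (fmul L (parity_part L c A) E') S U"
    unfolding parity_part_apply[OF S U] by simp
qed

text \<open>Evenness of \<open>H\<close> is the relation of \<open>fexp_shift\<close> with
  \<open>z = 0\<close> and the parity operator as \<open>Y\<close>; comparing entries of the
  resulting commutation gives the claim.\<close>

lemma homogeneous_fexp: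
  assumes "even_op L H"
  shows "homogeneous L False (fexp L (fscale z H))"
  unfolding homogeneous_def
proof (intro allI impI)
  fix S U assume S: "S \<subseteq> {..<L}" and U: "U \<subseteq> {..<L}" and nz: "fexp L (fscale z H) S U \<noteq> 0"
  have "fmul L (fexp L (fscale z H)) (parity_h L) S U =
      exp (z * 0) * fmul L (parity_h L) (fexp L (fscale z H)) S U"
    using assms S U by (intro fexp_shift) (auto simp: even_op_def)
  then have "(-1::complex) ^ card U = (-1) ^ card S"
    using nz by (simp add: fmul_parity_h_left[OF S] fmul_parity_h_right[OF U])
  then show "odd (card S + card U) = False"
    by (auto simp: minus_one_power_iff split: if_splits)
qed

section \<open>Assembling the time slices\<close>

text \<open>Distributivity, with the choices recorded as Boolean lists exactly as in
  \<open>tord\<close>. The induction appends at the end, so earlier choices keep their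
  positions.\<close>

lemma mprod_sum_parity_parts:
  assumes "\<And>l. l < k \<Longrightarrow> F l = fsum UNIV (G l)" "\<And>l c. l < k \<Longrightarrow> fres M (G l c) = G l c"
  shows "mprod M (map F [0..<k]) =
    fsum {cs :: bool list. length cs = k} (\<lambda>cs. mprod M (map (\<lambda>l. G l (cs ! l)) [0..<k]))"
  using assms
proof (induction k)
  case 0
  then show ?case by (simp add: fsum_def)
next
  case (Suc k)
  have F: "F k = fsum UNIV (G k)" "fres M (F k) = F k"
    using Suc.prems by (simp_all add: fres_fsum)
  have "mprod M (map F [0..<Suc k]) = fmul M (mprod M (map F [0..<k])) (F k)"
    by (simp add: mprod_snoc F(2))
  also have "\<dots> = fsum {cs. length cs = k} (\<lambda>cs. fsum UNIV (\<lambda>c.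
      fmul M (mprod M (map (\<lambda>l. G l (cs ! l)) [0..<k])) (G k c)))"
  proof -
    have IH: "mprod M (map F [0..<k]) =
        fsum {cs. length cs = k} (\<lambda>cs. mprod M (map (\<lambda>l. G l (cs ! l)) [0..<k]))"
      using Suc by simp
    show ?thesis
      unfolding F(1) IH fmul_fsum_left unfolding fmul_fsum_right ..
  qed
  also have "\<dots> = fsum {cs. length cs = k} (\<lambda>cs. fsum UNIV (\<lambda>c.
      mprod M (map (\<lambda>l. G l ((cs @ [c]) ! l)) [0..<Suc k])))"
  proof -
    have "fmul M (mprod M (map (\<lambda>l. G l (cs ! l)) [0..<k])) (G k c) =
        mprod M (map (\<lambda>l. G l ((cs @ [c]) ! l)) [0..<Suc k])" if "length cs = k" for cs c
    proof -
      have "fres M (G k c) = G k c" using Suc.prems by simp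
      moreover have "map (\<lambda>l. G l ((cs @ [c]) ! l)) [0..<Suc k] =
          map (\<lambda>l. G l (cs ! l)) [0..<k] @ [G k c]"
        using that by (auto simp: nth_append)
      ultimately show ?thesis
        by (simp only: mprod_snoc)
    qed
    then show ?thesis by (simp add: fsum_def)
  qed
  also have "\<dots> = fsum {cs. length cs = Suc k} (\<lambda>cs. mprod M (map (\<lambda>l. G l (cs ! l)) [0..<Suc k]))"
  proof (intro ext)
    fix S U
    show "fsum {cs. length cs = k} (\<lambda>cs. fsum UNIV (\<lambda>c.
        mprod M (map (\<lambda>l. G l ((cs @ [c]) ! l)) [0..<Suc k]))) S U =
      fsum {cs. length cs = Suc k} (\<lambda>cs. mprod M (map (\<lambda>l. G l (cs ! l)) [0..<Suc k])) S U"
      unfolding fsum_def sum.cartesian_product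
      by (rule sum.reindex_bij_witness[of _ "\<lambda>cs. (butlast cs, last cs)" "\<lambda>(cs, c). cs @ [c]"])
        (auto intro!: append_butlast_last_id)
  qed
  finally show ?case .
qed

lemma emb_mprod:
  assumes "t < N"
  shows "mprod (L * N) (map (\<lambda>l. fres (L * N) (emb L N t (X l))) ls) =
    fres (L * N) (emb L N t (mprod L (map X ls)))"
proof (induction ls)
  case Nil
  show ?case
    using emb_fid[OF assms, of L] emb_cong[OF assms, of L "fone L" fid]
    by (simp add: fone_def)
next
  case (Cons l ls)
  then show ?case
    using emb_fmul[OF assms, of L "X l"] by (simp add: fres_fmul)
qed

lemma filter_less_Suc:
  fixes g :: "'a \<Rightarrow> nat"
  assumes "sorted_wrt (\<lambda>i j. g j \<le> g i) xs"
  shows "filter (\<lambda>l. g l < Suc m) xs = filter (\<lambda>l. g l = m) xs @ filter (\<lambda>l. g l < m) xs"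
  using assms
proof (induction xs)
  case (Cons x xs)
  show ?case
  proof (cases "g x < m")
    case True
    then have "filter (\<lambda>l. g l = m) xs = []"
      using Cons.prems by (auto simp: filter_empty_conv)
    with True Cons show ?thesis by auto
  qed (use Cons in auto)
qed simp

text \<open>In a list of decreasing slices the insertions on one slice are adjacent and merge by
  multiplicativity of \<open>emb\<close>; a slice without insertions receives the unit.\<close>

lemma mprod_group_slices:
  assumes "sorted_wrt (\<lambda>i j. g j \<le> g i) xs" "m \<le> N"
  shows "mprod (L * N) (map (\<lambda>l. fres (L * N) (emb L N (g l) (X l))) (filter (\<lambda>l. g l < m) xs)) =
    rising L N (\<lambda>t. mprod L (map X (filter (\<lambda>l. g l = t) xs))) m"
  using assms(2)
proof (induction m)
  case 0
  then show ?case by (simp add: rising_0)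
next
  case (Suc m)
  have "map (\<lambda>l. fres (L * N) (emb L N (g l) (X l))) (filter (\<lambda>l. g l = m) xs) =
      map (\<lambda>l. fres (L * N) (emb L N m (X l))) (filter (\<lambda>l. g l = m) xs)"
    by auto
  then have "mprod (L * N) (map (\<lambda>l. fres (L * N) (emb L N (g l) (X l))) (filter (\<lambda>l. g l = m) xs)) =
      fres (L * N) (emb L N m (mprod L (map X (filter (\<lambda>l. g l = m) xs))))"
    using Suc.prems by (simp only: emb_mprod Suc_le_eq)
  then show ?case
    unfolding filter_less_Suc[OF assms(1)] map_append rising_Suc
    using Suc by (subst mprod_append) auto
qed

lemma fres_rising [simp]: "fres (L * N) (rising L N Y m) = rising L N Y m"
  unfolding rising_def by (rule fres_mprod) auto

text \<open>Turns the ascending product of the action into the descending one of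
  \<open>rising\<close>. The factor on slice \<open>m\<close> meets its partner \<open>G m\<close>,
  and the even factors of the earlier slices then commute past the merged operator, whatever the
  parity of \<open>G m\<close>.\<close>

lemma evolution_times_rising:
  assumes "homogeneous L False E" "m \<le> N"
  shows "fmul (L * N) (mprod (L * N) (map (\<lambda>t. fres (L * N) (emb L N t E)) [0..<m])) (rising L N G m) =
    rising L N (\<lambda>t. fmul L E (G t)) m"
  using assms(2)
proof (induction m)
  case 0
  then show ?case by (simp add: rising_0)
next
  case (Suc m)
  let ?M = "L * N" and ?e = "\<lambda>t A. fres (L * N) (emb L N t A)"
  let ?asc = "mprod ?M (map (\<lambda>t. ?e t E) [0..<m])"
  have comm: "fmul ?M (mprod ?M (map (\<lambda>t. ?e t E) ts)) (?e m B) =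
      fmul ?M (?e m B) (mprod ?M (map (\<lambda>t. ?e t E) ts))" if "set ts \<subseteq> {..<m}" for ts B
    using that
  proof (induction ts)
    case (Cons t ts)
    have "fmul ?M (?e t E) (?e m B) = fmul ?M (?e m B) (?e t E)"
      using Cons.prems Suc.prems assms(1) by (intro emb_even_commute) auto
    then show ?case
      using Cons by (simp add: fmul_assoc) (simp add: fmul_assoc[symmetric])
  qed simp
  have "fmul ?M (mprod ?M (map (\<lambda>t. ?e t E) [0..<Suc m])) (rising L N G (Suc m)) =
      fmul ?M (fmul ?M ?asc (?e m E)) (fmul ?M (?e m (G m)) (rising L N G m))"
    by (simp add: mprod_snoc rising_Suc)
  also have "\<dots> = fmul ?M (fmul ?M ?asc (fmul ?M (?e m E) (?e m (G m)))) (rising L N G m)"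
    by (simp add: fmul_assoc)
  also have "fmul ?M (?e m E) (?e m (G m)) = ?e m (fmul L E (G m))"
    using emb_fmul[of m N L E "G m"] Suc.prems by (simp add: fres_fmul)
  also have "fmul ?M ?asc (?e m (fmul L E (G m))) = fmul ?M (?e m (fmul L E (G m))) ?asc"
    by (rule comm) auto
  also have "fmul ?M \<dots> (rising L N G m) = rising L N (\<lambda>t. fmul L E (G t)) (Suc m)"
    using Suc by (simp add: fmul_assoc rising_Suc)
  finally show ?case .
qed

section \<open>Telescoping of the Heisenberg factors\<close>

definition evol :: "nat \<Rightarrow> fop \<Rightarrow> complex \<Rightarrow> fop" where
  "evol L H z = fres L (fexp L (fscale z H))"

lemma fres_evol [simp]: "fres L (evol L H z) = evol L H z"
  by (simp add: evol_def)

lemma evol_add: "fmul L (evol L H a) (evol L H b) = evol L H (a + b)"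
  unfolding evol_def fres_fmul[symmetric] by (rule fres_eqI) (rule fexp_add)

lemma evol_add_left: "fmul L (evol L H a) (fmul L (evol L H b) C) = fmul L (evol L H (a + b)) C"
  by (simp add: fmul_assoc[symmetric] evol_add)

lemma evol_0: "evol L H 0 = fone L"
  unfolding evol_def fone_def by (rule fres_eqI) (rule fexp_zero)

lemma mprod_conjugate:
  assumes "\<And>l. l \<in> set ls \<Longrightarrow> fres L (X l) = X l"
  shows "mprod L (map (\<lambda>l. fmul L (evol L H (- z)) (fmul L (X l) (evol L H z))) ls) =
    fmul L (evol L H (- z)) (fmul L (mprod L (map X ls)) (evol L H z))"
  using assms
proof (induction ls)
  case Nil
  then show ?case
    using fone_left[of L "evol L H z"] by (simp add: evol_add evol_0)
next
  case (Cons l ls)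
  have "fres L (mprod L (map X ls)) = mprod L (map X ls)"
    using Cons.prems by (intro fres_mprod) auto
  then have "fmul L (fone L) (fmul L (mprod L (map X ls)) (evol L H z)) =
      fmul L (mprod L (map X ls)) (evol L H z)"
    by (metis fmul_assoc fone_left)
  then show ?case
    using Cons by (simp add: fmul_assoc evol_add_left evol_0)
qed

text \<open>The prefactor \<open>(m + 1) z\<close> meets \<open>- m z\<close> on the left of slice
  \<open>m\<close> and leaves one step \<open>z\<close>; the factor \<open>m z\<close> on its right
  is the prefactor for the slices below.\<close>

lemma heisenberg_group_slices:
  assumes "sorted_wrt (\<lambda>i j. g j \<le> g i) xs" "\<And>l. l \<in> set xs \<Longrightarrow> fres L (X l) = X l"
  shows "fmul L (evol L H (of_nat m * z)) (mprod L (map (\<lambda>l. fmul L (evol L H (- (of_nat (g l) * z)))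
      (fmul L (X l) (evol L H (of_nat (g l) * z)))) (filter (\<lambda>l. g l < m) xs))) =
    mprod L (map (\<lambda>t. fmul L (evol L H z) (mprod L (map X (filter (\<lambda>l. g l = t) xs)))) (rev [0..<m]))"
proof (induction m)
  case 0
  then show ?case by (simp add: evol_0)
next
  case (Suc m)
  let ?h = "\<lambda>l. fmul L (evol L H (- (of_nat (g l) * z))) (fmul L (X l) (evol L H (of_nat (g l) * z)))"
  let ?G = "mprod L (map X (filter (\<lambda>l. g l = m) xs))"
  let ?rest = "mprod L (map ?h (filter (\<lambda>l. g l < m) xs))"
  have closed: "fres L (?h l) = ?h l" if "l \<in> set xs" for l
    using that assms(2) by (intro fres_fmul_closed) auto
  have eq: "map ?h (filter (\<lambda>l. g l = m) xs) = map (\<lambda>l. fmul L (evol L H (- (of_nat m * z)))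
      (fmul L (X l) (evol L H (of_nat m * z)))) (filter (\<lambda>l. g l = m) xs)"
    by auto
  have "mprod L (map ?h (filter (\<lambda>l. g l = m) xs)) =
      fmul L (evol L H (- (of_nat m * z))) (fmul L ?G (evol L H (of_nat m * z)))"
    unfolding eq by (rule mprod_conjugate) (use assms(2) in auto)
  then have "mprod L (map ?h (filter (\<lambda>l. g l < Suc m) xs)) =
      fmul L (fmul L (evol L H (- (of_nat m * z))) (fmul L ?G (evol L H (of_nat m * z)))) ?rest"
    unfolding filter_less_Suc[OF assms(1)] map_append
    using closed by (subst mprod_append) auto
  then have "fmul L (evol L H (of_nat (Suc m) * z)) (mprod L (map ?h (filter (\<lambda>l. g l < Suc m) xs))) =
      fmul L (evol L H z) (fmul L ?G (fmul L (evol L H (of_nat m * z)) ?rest))"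
    by (simp add: fmul_assoc evol_add_left algebra_simps)
  then show ?case
    by (simp add: Suc fmul_assoc)
qed

theorem theorem4:
  fixes L N k :: nat and \<epsilon> :: real and H :: fop
    and Ops :: "nat \<Rightarrow> fop" and ts :: "nat \<Rightarrow> nat"
  assumes "L \<ge> 1" and "N \<ge> 1" and "\<epsilon> > 0"
    and "hermitian_op L H" and "even_op L H"
    and "\<forall>l<k. ts l < N"
  shows "ftr (L * N) (fmul (L * N) (parity_big L N)
            (fmul (L * N) (action_op L N \<epsilon> H)
              (fprod (L * N) (map (\<lambda>l. emb L N (ts l) (Ops l)) [0..<k]))))
       = ftr L (fmul L (fexp L (fscale (- \<i> * complex_of_real (\<epsilon> * real N)) H))
            (tord L (\<lambda>l. \<epsilon> * real (ts l)) (\<lambda>l. heis L H (\<epsilon> * real (ts l)) (Ops l)) k))"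
proof -
  let ?M = "L * N"
  define z where "z = - \<i> * complex_of_real \<epsilon>"
  define lab where "lab = (\<lambda>l. \<epsilon> * real (ts l))"
  define \<sigma> where "\<sigma> = tord_perm lab k"
  define E where "E = evol L H z"
  \<comment> \<open>One parity choice per insertion, truncated so that these operators can be used
    where fixed points of \<open>fres\<close> are required.\<close>
  define X where "X = (\<lambda>(cs :: bool list) l. fres L (parity_part L (cs ! l) (Ops l)))"
  define e where "e = (\<lambda>t A. fres ?M (emb L N t A))"
  define G where "G = (\<lambda>cs t. mprod L (map (X cs) (filter (\<lambda>l. ts l = t) \<sigma>)))"
  define evolution where "evolution = mprod ?M (map (\<lambda>t. e t E) [0..<N])"
  let ?CS = "{cs :: bool list. length cs = k}"

  have \<sigma>: "set \<sigma> = {0..<k}" "sorted_wrt (\<lambda>i j. ts j \<le> ts i) \<sigma>"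
  proof -
    show "set \<sigma> = {0..<k}" by (simp add: \<sigma>_def tord_perm_def)
    have "sorted_wrt (stable_less (\<lambda>l. - lab l)) \<sigma>"
      unfolding \<sigma>_def tord_perm_def by (rule sorted_wrt_sort_key) simp
    then show "sorted_wrt (\<lambda>i j. ts j \<le> ts i) \<sigma>"
      by (rule sorted_wrt_mono_rel[rotated])
        (use \<open>\<epsilon> > 0\<close> in \<open>auto simp: stable_less_def lab_def\<close>)
  qed
  have filter_all: "filter (\<lambda>l. ts l < N) \<sigma> = \<sigma>"
    using assms(6) \<sigma>(1) by (auto simp: filter_id_conv)
  have E_even: "homogeneous L False E"
    unfolding E_def evol_def homogeneous_fres by (rule homogeneous_fexp[OF assms(5)])

  have action: "fres ?M (action_op L N \<epsilon> H) = fmul ?M (fres ?M (translation L N \<epsilon>)) evolution"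
  proof -
    have "fres ?M (fexp ?M (fscale (- \<i> * complex_of_real \<epsilon>) (emb L N t H))) = e t E" if "t < N" for t
      unfolding e_def E_def evol_def z_def emb_fscale[symmetric] fexp_emb[OF that]
      by (rule emb_cong[OF that]) simp
    then have "map (fres ?M) (map (\<lambda>t. fexp ?M (fscale (- \<i> * complex_of_real \<epsilon>) (emb L N t H))) [0..<N]) =
        map (\<lambda>t. e t E) [0..<N]"
      by auto
    then show ?thesis
      unfolding action_op_def fres_fmul fres_fprod evolution_def by (simp only:)
  qed

  have insertions: "fres ?M (fprod ?M (map (\<lambda>l. emb L N (ts l) (Ops l)) [0..<k])) =
      fsum ?CS (\<lambda>cs. fscale ((-1) ^ tord_gamma lab k cs) (rising L N (G cs) N))"
  proof -
    have "fres ?M (fprod ?M (map (\<lambda>l. emb L N (ts l) (Ops l)) [0..<k])) =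
        mprod ?M (map (\<lambda>l. e (ts l) (Ops l)) [0..<k])"
      by (simp add: fres_fprod e_def o_def)
    also have "\<dots> = fsum ?CS (\<lambda>cs. mprod ?M (map (\<lambda>l. e (ts l) (X cs l)) [0..<k]))"
      unfolding X_def e_def using assms(6)
      by (intro mprod_sum_parity_parts emb_sum_parity_parts) auto
    also have "\<dots> = fsum ?CS (\<lambda>cs. fscale ((-1) ^ tord_gamma lab k cs) (rising L N (G cs) N))"
    proof -
      have "mprod ?M (map (\<lambda>l. e (ts l) (X cs l)) [0..<k]) =
          fscale ((-1) ^ tord_gamma lab k cs) (rising L N (G cs) N)" for cs
      proof -
        have "mprod ?M (map (\<lambda>l. e (ts l) (X cs l)) [0..<k]) =
            fscale ((-1) ^ inversions (\<lambda>l. - lab l) ((!) cs) [0..<k])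
              (mprod ?M (map (\<lambda>l. e (ts l) (X cs l)) (sort_key (\<lambda>l. - lab l) [0..<k])))"
        proof (rule mprod_sort_key)
          fix i j assume ij: "i \<in> set [0..<k]" "j \<in> set [0..<k]" "- lab i \<noteq> - lab j"
          then have "ts i \<noteq> ts j" by (auto simp: lab_def)
          then show "fmul ?M (e (ts i) (X cs i)) (e (ts j) (X cs j)) =
              fscale (if cs ! i \<and> cs ! j then -1 else 1)
                (fmul ?M (e (ts j) (X cs j)) (e (ts i) (X cs i)))"
            unfolding e_def X_def using ij assms(6)
            by (intro emb_graded_commute)
              (simp_all only: homogeneous_fres homogeneous_parity_part, auto)
        qed simp
        \<comment> \<open>All insertions lie on slices below \<open>N\<close>, so the filter keeps
          everything; it only provides the form of \<open>mprod_group_slices\<close> at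
          \<open>m = N\<close>.\<close>
        also have "sort_key (\<lambda>l. - lab l) [0..<k] = filter (\<lambda>l. ts l < N) \<sigma>"
          unfolding filter_all by (simp add: \<sigma>_def tord_perm_def)
        also have "mprod ?M (map (\<lambda>l. e (ts l) (X cs l)) (filter (\<lambda>l. ts l < N) \<sigma>)) =
            rising L N (G cs) N"
          unfolding e_def G_def by (rule mprod_group_slices[OF \<sigma>(2) order_refl])
        finally show ?thesis by (simp add: tord_gamma_eq_inversions)
      qed
      then show ?thesis by simp
    qed
    finally show ?thesis .
  qed

  have lhs: "ftr ?M (fmul ?M (parity_big L N) (fmul ?M (action_op L N \<epsilon> H)
        (fprod ?M (map (\<lambda>l. emb L N (ts l) (Ops l)) [0..<k])))) =
      (\<Sum>cs\<in>?CS. (-1) ^ tord_gamma lab k cs *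
        ftr L (mprod L (map (\<lambda>t. fmul L E (G cs t)) (rev [0..<N]))))"
  proof -
    have "ftr ?M (fmul ?M (parity_big L N) (fmul ?M (action_op L N \<epsilon> H)
        (fprod ?M (map (\<lambda>l. emb L N (ts l) (Ops l)) [0..<k])))) =
        ftr ?M (fmul ?M (fres ?M (parity_big L N)) (fmul ?M (fmul ?M (fres ?M (translation L N \<epsilon>)) evolution)
          (fsum ?CS (\<lambda>cs. fscale ((-1) ^ tord_gamma lab k cs) (rising L N (G cs) N)))))"
      by (subst ftr_fres[symmetric]) (simp only: fres_fmul action insertions)
    also have "\<dots> = (\<Sum>cs\<in>?CS. (-1) ^ tord_gamma lab k cs *
        ftr ?M (fmul ?M (fres ?M (parity_big L N)) (fmul ?M (fres ?M (translation L N \<epsilon>))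
          (fmul ?M evolution (rising L N (G cs) N)))))"
      by (simp only: fmul_fsum_right fmul_fscale_right fmul_assoc ftr_fsum ftr_fscale)
    also have "\<dots> = (\<Sum>cs\<in>?CS. (-1) ^ tord_gamma lab k cs *
        ftr L (mprod L (map (\<lambda>t. fmul L E (G cs t)) (rev [0..<N]))))"
    proof (intro sum.cong refl arg_cong2[where f = "(*)"])
      fix cs
      have "fmul ?M evolution (rising L N (G cs) N) = rising L N (\<lambda>t. fmul L E (G cs t)) N"
        unfolding evolution_def e_def by (rule evolution_times_rising[OF E_even order_refl])
      then have "fmul ?M (fres ?M (parity_big L N)) (fmul ?M (fres ?M (translation L N \<epsilon>))
          (fmul ?M evolution (rising L N (G cs) N))) =
          fres ?M (fmul ?M (parity_big L N) (fmul ?M (translation L N \<epsilon>)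
            (rising L N (\<lambda>t. fmul L E (G cs t)) N)))"
        by (simp add: fres_fmul)
      then show "ftr ?M (fmul ?M (fres ?M (parity_big L N)) (fmul ?M (fres ?M (translation L N \<epsilon>))
          (fmul ?M evolution (rising L N (G cs) N)))) =
          ftr L (mprod L (map (\<lambda>t. fmul L E (G cs t)) (rev [0..<N])))"
        by (simp only: ftr_fres trace_translation[OF assms(3,2)])
    qed
    finally show ?thesis .
  qed

  have "ftr L (fmul L (fexp L (fscale (- \<i> * complex_of_real (\<epsilon> * real N)) H))
        (tord L lab (\<lambda>l. heis L H (lab l) (Ops l)) k)) =
      ftr L (fmul L (evol L H (of_nat N * z)) (fres L (tord L lab (\<lambda>l. heis L H (lab l) (Ops l)) k)))"
    by (subst ftr_fres[symmetric]) (simp add: fres_fmul evol_def z_def mult_ac)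
  also have "fres L (tord L lab (\<lambda>l. heis L H (lab l) (Ops l)) k) =
      fsum ?CS (\<lambda>cs. fscale ((-1) ^ tord_gamma lab k cs)
        (mprod L (map (\<lambda>l. fmul L (evol L H (- (of_nat (ts l) * z)))
          (fmul L (X cs l) (evol L H (of_nat (ts l) * z)))) \<sigma>)))"
  proof -
    have "fres L (parity_part L c (heis L H (lab l) (Ops l))) =
        fmul L (evol L H (- (of_nat (ts l) * z)))
          (fmul L (fres L (parity_part L c (Ops l))) (evol L H (of_nat (ts l) * z)))" for c l
    proof -
      \<comment> \<open>With \<open>z = - i \<epsilon>\<close> all Heisenberg exponents become
        integer multiples of a single one, as the telescoping requires.\<close>
      have "\<i> * complex_of_real (lab l) = - (of_nat (ts l) * z)"
        "- \<i> * complex_of_real (lab l) = of_nat (ts l) * z"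
        by (simp_all add: lab_def z_def)
      then show ?thesis
        unfolding heis_def evol_def
        by (simp only: parity_part_conjugate homogeneous_fexp[OF assms(5)])
    qed
    then show ?thesis
      unfolding tord_def fres_fsum fres_fscale fres_fprod \<sigma>_def[symmetric] X_def map_map o_def
      by (simp only:)
  qed
  also have "ftr L (fmul L (evol L H (of_nat N * z)) \<dots>) =
      (\<Sum>cs\<in>?CS. (-1) ^ tord_gamma lab k cs *
        ftr L (fmul L (evol L H (of_nat N * z)) (mprod L (map (\<lambda>l. fmul L (evol L H (- (of_nat (ts l) * z)))
          (fmul L (X cs l) (evol L H (of_nat (ts l) * z)))) \<sigma>))))"
    by (simp only: fmul_fsum_right fmul_fscale_right ftr_fsum ftr_fscale)
  \<comment> \<open>The prefactor \<open>e^{-iTH}\<close> is the evolution by \<open>N z\<close>, so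
    telescoping applies at \<open>m = N\<close> and each term becomes the slice product found on the
    big space for the same \<open>cs\<close>.\<close>
  also have "\<dots> = (\<Sum>cs\<in>?CS. (-1) ^ tord_gamma lab k cs *
        ftr L (mprod L (map (\<lambda>t. fmul L E (G cs t)) (rev [0..<N]))))"
    unfolding E_def G_def
    using heisenberg_group_slices[OF \<sigma>(2), of L "X _" H N z]
    by (simp only: filter_all X_def fres_fres)
  finally show ?thesis
    unfolding lhs lab_def by (simp only:)
qed

end
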